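(* Let $k$ be a field and let $(\mathcal C,\otimes,I,C)$ be a braided tensor category with a forgetful functor $F$ from $\mathcal C$ to the category of $k$-vector spaces such that $F(U\otimes V)=F(U)\otimes F(V)$ and $F(I)=k$. Let $H$ be a braided Hopf algebra in $\mathcal C$ with $C_{H,H}=C_{H,H}^{-1}$, and let $H^d\subseteq H^*=\mathrm{Hom}_k(H,k)$ be a faithful quasi-dual of $H$ under the evaluation $\langle\,,\rangle$. Assume that $\mathcal C$ has equalizers and that there exists the maximal rational $H^d$-submodule $H^{d\,rat}$ of the regular $H^d$-module $H^d$. If $\rightharpoonup$ is a morphism from $H\otimes H^d$ to $H^d$ in $\mathcal C$ whose restriction to $H\otimes H^{d\,rat}$ is a morphism to $H^{d\,rat}$ in $\mathcal C$, then $$H^{d\,rat}\cong \int^l_{H^d}\otimes H\qquad\text{as }H\text{-Hopf modules in }\mathcal C .$$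
   Context: $\mathcal C$ is regarded as strict; an object's name also denotes its identity morphism. A braided Hopf algebra in $\mathcal C$ is a Hopf algebra object $(H,m,\eta,\Delta,\epsilon,S)$ in $\mathcal C$ (with $\Delta$ multiplicative for the braided tensor product algebra structure on $H\otimes H$). Faithful quasi-dual: an algebra $N$ in $\mathcal C$ together with a morphism $\langle\,,\rangle:N\otimes H\to I$ is a left quasi-dual of $H$ if $\langle\,,\rangle(m_N\otimes H)=(\langle\,,\rangle\otimes\langle\,,\rangle)(N\otimes C_{N,H}\otimes H)(N\otimes N\otimes\Delta)$ and $\langle\,,\rangle(\eta_N\otimes H)=\epsilon$. It is a faithful quasi-dual, written $H^d$, if moreover for all objects $U,V$ and all morphisms $f,f':U\to V\otimes N$, $g,g':U\to H\otimes V$ in $\mathcal C$: $(V\otimes\langle\,,\rangle)(f\otimes H)=(V\otimes\langle\,,\rangle)(f'\otimes H)$ implies $f=f'$, and $(\langle\,,\rangle\otimes V)(N\otimes g)=(\langle\,,\rangle\otimes V)(N\otimes g')$ implies $g=g'$. The map $\rightharpoonup:H\otimes H^d\to H^d$ is the one determined by $\langle\,,\rangle(\rightharpoonup\otimes H)=\langle\,,\rangle(H^d\otimes m)(H^d\otimes C_{H,H})(C_{H,H^d}\otimes H)$. A left $H^d$-module $(M,\alpha)$ in $\mathcal C$ is rational if there is a morphism $\rho:M\to M\otimes H$ in $\mathcal C$ with $(M\otimes\langle\,,\rangle)(C_{H^d,M}\otimes H)(H^d\otimes\rho)=\alpha$. The regular module is $H^d$ with action its multiplication. $\int^l_{H^d}=\{f\in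 H^d\mid gf=g(1)f\text{ for all }g\in H^d\}$, the product being that of $H^d$. A (right) $H$-Hopf module in $\mathcal C$ is an object $M$ with a right $H$-module structure $\alpha:M\otimes H\to M$ and a right $H$-comodule structure $\rho:M\to M\otimes H$ such that $\rho\,\alpha=(\alpha\otimes m)(M\otimes C_{H,H}\otimes H)(\rho\otimes\Delta)$. The Hopf module structure on $H^{d\,rat}$ has action $\leftharpoondown\;=\;\rightharpoonup(S\otimes H^{d\,rat})\,C_{H^{d\,rat},H}$ and coaction the morphism $\rho$ from the rationality condition; that on $V\otimes H$ is given by $V\otimes m$ and $V\otimes\Delta$.
   Formalization: The set of left integrals need not underlie an object of the category, so the integrals are read as the largest subobject of the quasi-dual whose elements are integrals (proved to exist); it contains all integrals whenever they form a subobject. *)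

theory Defs
  imports "HOL.Vector_Spaces"
begin

section \<open>Strict braided tensor categories\<close>

text \<open>
  The types \<open>'o\<close> and \<open>'m\<close> are the collections of all objects and of all morphisms. As the
  tensor category is strict, associativity and unitality of the tensor product are equations
  between objects and between morphisms.
\<close>

record ('o, 'm) tensor_cat =
  Source :: "'m \<Rightarrow> 'o"
  Target :: "'m \<Rightarrow> 'o"
  Ident  :: "'o \<Rightarrow> 'm"  ("\<one>\<index>")
  Comp   :: "'m \<Rightarrow> 'm \<Rightarrow> 'm"  (infixr "\<cdot>\<index>" 65)
  Unit   :: "'o"  ("\<I>\<index>")
  TensO  :: "'o \<Rightarrow> 'o \<Rightarrow> 'o"  (infixr "\<boxtimes>\<index>" 75)
  TensM  :: "'m \<Rightarrow> 'm \<Rightarrow> 'm"  (infixr "\<otimes>\<index>" 75)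
  Braid  :: "'o \<Rightarrow> 'o \<Rightarrow> 'm"  ("\<sigma>\<index>")

definition hom :: "('o, 'm) tensor_cat \<Rightarrow> 'o \<Rightarrow> 'o \<Rightarrow> 'm set" where
  "hom C A B = {f. Source C f = A \<and> Target C f = B}"

definition inverse_of :: "('o, 'm) tensor_cat \<Rightarrow> 'm \<Rightarrow> 'm \<Rightarrow> bool" where
  "inverse_of C f g \<longleftrightarrow>
     g \<in> hom C (Target C f) (Source C f) \<and>
     g \<cdot>\<^bsub>C\<^esub> f = \<one>\<^bsub>C\<^esub> (Source C f) \<and> f \<cdot>\<^bsub>C\<^esub> g = \<one>\<^bsub>C\<^esub> (Target C f)"

definition iso_mor :: "('o, 'm) tensor_cat \<Rightarrow> 'm \<Rightarrow> bool" where
  "iso_mor C f \<longleftrightarrow> (\<exists>g. inverse_of C f g)"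

locale braided_tensor_category =
  fixes C :: "('o, 'm) tensor_cat" (structure)
  assumes ident_hom: "\<one> A \<in> hom C A A"
    and comp_hom: "\<lbrakk>f \<in> hom C A B; g \<in> hom C B D\<rbrakk> \<Longrightarrow> g \<cdot> f \<in> hom C A D"
    and comp_ident_right: "f \<in> hom C A B \<Longrightarrow> f \<cdot> \<one> A = f"
    and comp_ident_left: "f \<in> hom C A B \<Longrightarrow> \<one> B \<cdot> f = f"
    and comp_assoc:
      "\<lbrakk>f \<in> hom C A B; g \<in> hom C B D; h \<in> hom C D E\<rbrakk> \<Longrightarrow> (h \<cdot> g) \<cdot> f = h \<cdot> (g \<cdot> f)"
    and tens_hom:
      "\<lbrakk>f \<in> hom C A B; f' \<in> hom C A' B'\<rbrakk> \<Longrightarrow> f \<otimes> f' \<in> hom C (A \<boxtimes> A') (B \<boxtimes> B')"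
    and tens_ident: "\<one> A \<otimes> \<one> B = \<one> (A \<boxtimes> B)"
    and tens_comp:
      "\<lbrakk>f \<in> hom C A B; g \<in> hom C B D; f' \<in> hom C A' B'; g' \<in> hom C B' D'\<rbrakk>
        \<Longrightarrow> (g \<cdot> f) \<otimes> (g' \<cdot> f') = (g \<otimes> g') \<cdot> (f \<otimes> f')"
    and tensO_assoc: "(A \<boxtimes> B) \<boxtimes> D = A \<boxtimes> (B \<boxtimes> D)"
    and tensM_assoc: "(f \<otimes> g) \<otimes> h = f \<otimes> (g \<otimes> h)"
    and tensO_unit: "\<I> \<boxtimes> A = A" "A \<boxtimes> \<I> = A"
    and tensM_unit: "\<one> \<I> \<otimes> f = f" "f \<otimes> \<one> \<I> = f"
    and braid_hom: "\<sigma> A B \<in> hom C (A \<boxtimes> B) (B \<boxtimes> A)"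
    and braid_iso: "iso_mor C (\<sigma> A B)"
    and braid_natural:
      "\<lbrakk>f \<in> hom C A A'; g \<in> hom C B B'\<rbrakk> \<Longrightarrow> \<sigma> A' B' \<cdot> (f \<otimes> g) = (g \<otimes> f) \<cdot> \<sigma> A B"
    and hexagon_right: "\<sigma> A (B \<boxtimes> D) = (\<one> B \<otimes> \<sigma> A D) \<cdot> (\<sigma> A B \<otimes> \<one> D)"
    and hexagon_left: "\<sigma> (A \<boxtimes> B) D = (\<sigma> A D \<otimes> \<one> B) \<cdot> (\<one> A \<otimes> \<sigma> B D)"

definition is_equalizer ::
    "('o, 'm) tensor_cat \<Rightarrow> 'o \<Rightarrow> 'm \<Rightarrow> 'm \<Rightarrow> 'o \<Rightarrow> 'm \<Rightarrow> bool" where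
  "is_equalizer C A f g E e \<longleftrightarrow>
     e \<in> hom C E A \<and> f \<cdot>\<^bsub>C\<^esub> e = g \<cdot>\<^bsub>C\<^esub> e \<and>
     (\<forall>X. \<forall>x \<in> hom C X A. f \<cdot>\<^bsub>C\<^esub> x = g \<cdot>\<^bsub>C\<^esub> x \<longrightarrow> (\<exists>!y. y \<in> hom C X E \<and> e \<cdot>\<^bsub>C\<^esub> y = x))"

definition has_equalizers :: "('o, 'm) tensor_cat \<Rightarrow> bool" where
  "has_equalizers C \<longleftrightarrow>
     (\<forall>A B. \<forall>f \<in> hom C A B. \<forall>g \<in> hom C A B. \<exists>E e. is_equalizer C A f g E e)"


section \<open>The forgetful functor to vector spaces\<close>

text \<open>
  The vector spaces \<open>F U\<close> are subspaces of one ambient \<open>k\<close>-vector space on the type \<open>'v\<close>. This is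
  no restriction up to isomorphism: a family of vector spaces indexed by \<open>'o\<close> embeds into its
  direct sum. Nothing relates the positions of the different \<open>F U\<close> in the ambient space.
\<close>

definition linear_on ::
    "('k \<Rightarrow> 'v \<Rightarrow> 'v) \<Rightarrow> 'v set \<Rightarrow> 'v set \<Rightarrow> ('v::ab_group_add \<Rightarrow> 'v) \<Rightarrow> bool" where
  "linear_on s V W f \<longleftrightarrow>
     (\<forall>x\<in>V. f x \<in> W) \<and> (\<forall>x\<in>V. \<forall>y\<in>V. f (x + y) = f x + f y) \<and>
     (\<forall>a. \<forall>x\<in>V. f (s a x) = s a (f x))"

definition bilinear_on ::
    "('k \<Rightarrow> 'v \<Rightarrow> 'v) \<Rightarrow> 'v set \<Rightarrow> 'v set \<Rightarrow> 'v set \<Rightarrow> ('v::ab_group_add \<Rightarrow> 'v \<Rightarrow> 'v) \<Rightarrow> bool" where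
  "bilinear_on s V W T t \<longleftrightarrow>
     (\<forall>v\<in>V. linear_on s W T (\<lambda>w. t v w)) \<and> (\<forall>w\<in>W. linear_on s V T (\<lambda>v. t v w))"

text \<open>
  \<open>T\<close> together with \<open>t\<close> is a tensor product of \<open>V\<close> and \<open>W\<close>: the map \<open>t\<close> is a universal bilinear
  map. Letting the target \<open>X\<close> range over the subspaces of the ambient space suffices to determine
  the tensor product, as soon as the ambient space is nonzero: a line \<open>X\<close> already forces the
  canonical map from the tensor product to \<open>T\<close> to be bijective on the dual spaces.
\<close>

definition is_tensor_product ::
    "('k::field \<Rightarrow> 'v \<Rightarrow> 'v) \<Rightarrow> 'v set \<Rightarrow> 'v set \<Rightarrow> 'v set \<Rightarrow> ('v::ab_group_add \<Rightarrow> 'v \<Rightarrow> 'v) \<Rightarrow> bool"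
    where
  "is_tensor_product s V W T t \<longleftrightarrow>
     bilinear_on s V W T t \<and>
     (\<forall>X \<beta>. module.subspace s X \<longrightarrow> bilinear_on s V W X \<beta> \<longrightarrow>
        (\<exists>\<gamma>. linear_on s T X \<gamma> \<and> (\<forall>v\<in>V. \<forall>w\<in>W. \<gamma> (t v w) = \<beta> v w) \<and>
           (\<forall>\<gamma>'. linear_on s T X \<gamma>' \<and> (\<forall>v\<in>V. \<forall>w\<in>W. \<gamma>' (t v w) = \<beta> v w)
              \<longrightarrow> (\<forall>x\<in>T. \<gamma>' x = \<gamma> x))))"

text \<open>
  \<open>Sp F U\<close> is the vector space \<open>F(U)\<close>, \<open>Mp F f\<close> the linear map \<open>F(f)\<close>, which is meaningful on
  \<open>Sp F (Source C f)\<close> only, \<open>Tens F U V u v\<close> the element \<open>u \<otimes> v\<close> of \<open>F(U \<otimes> V) = F(U) \<otimes> F(V)\<close>, and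
  \<open>One F\<close> the element \<open>1\<close> of \<open>F(I) = k\<close>.
\<close>

record ('k, 'o, 'm, 'v) vect_functor =
  Smult :: "'k \<Rightarrow> 'v \<Rightarrow> 'v"
  Sp    :: "'o \<Rightarrow> 'v set"
  Mp    :: "'m \<Rightarrow> 'v \<Rightarrow> 'v"
  Tens  :: "'o \<Rightarrow> 'o \<Rightarrow> 'v \<Rightarrow> 'v \<Rightarrow> 'v"
  One   :: "'v"

text \<open>
  A forgetful functor is faithful. The equations \<open>F(U \<otimes> V) = F(U) \<otimes> F(V)\<close> and \<open>F(I) = k\<close> hold
  for \<open>F\<close> as a tensor functor, i.e. they are compatible with morphisms and with the (strict)
  associativity and unit constraints. There is no relation between the braiding and the flip of
  vector spaces.
\<close>

locale forgetful_functor =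
  braided_tensor_category C + vector_space "Smult F"
  for C :: "('o, 'm) tensor_cat" (structure)
    and F :: "('k::field, 'o, 'm, 'v::ab_group_add) vect_functor" +
  assumes Sp_subspace: "module.subspace (Smult F) (Sp F U)"
    and Mp_linear: "f \<in> hom C U V \<Longrightarrow> linear_on (Smult F) (Sp F U) (Sp F V) (Mp F f)"
    and Mp_ident: "u \<in> Sp F U \<Longrightarrow> Mp F (\<one> U) u = u"
    and Mp_comp: "\<lbrakk>f \<in> hom C U V; g \<in> hom C V W; u \<in> Sp F U\<rbrakk> \<Longrightarrow> Mp F (g \<cdot> f) u = Mp F g (Mp F f u)"
    and Mp_faithful:
      "\<lbrakk>f \<in> hom C U V; g \<in> hom C U V; \<And>u. u \<in> Sp F U \<Longrightarrow> Mp F f u = Mp F g u\<rbrakk> \<Longrightarrow> f = g"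
    and Sp_tens: "is_tensor_product (Smult F) (Sp F U) (Sp F V) (Sp F (U \<boxtimes> V)) (Tens F U V)"
    and Mp_tens:
      "\<lbrakk>f \<in> hom C U U'; g \<in> hom C V V'; u \<in> Sp F U; v \<in> Sp F V\<rbrakk>
        \<Longrightarrow> Mp F (f \<otimes> g) (Tens F U V u v) = Tens F U' V' (Mp F f u) (Mp F g v)"
    and Tens_assoc:
      "\<lbrakk>u \<in> Sp F U; v \<in> Sp F V; w \<in> Sp F W\<rbrakk>
        \<Longrightarrow> Tens F (U \<boxtimes> V) W (Tens F U V u v) w = Tens F U (V \<boxtimes> W) u (Tens F V W v w)"
    and One_nonzero: "One F \<noteq> 0"
    and Sp_unit: "Sp F \<I> = range (\<lambda>c. Smult F c (One F))"
    and Tens_unit: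
      "u \<in> Sp F U \<Longrightarrow> Tens F \<I> U (One F) u = u"
      "u \<in> Sp F U \<Longrightarrow> Tens F U \<I> u (One F) = u"

text \<open>The identification of \<open>F(I)\<close> with \<open>k\<close>.\<close>

definition to_scalar :: "('k, 'o, 'm, 'v) vect_functor \<Rightarrow> 'v \<Rightarrow> 'k" where
  "to_scalar F x = (THE c. x = Smult F c (One F))"

text \<open>
  A subobject of \<open>X\<close> is an object whose underlying vector space is, via the morphism \<open>i\<close>, a subspace
  of that of \<open>X\<close>.
\<close>

definition subobject ::
    "('o, 'm) tensor_cat \<Rightarrow> ('k, 'o, 'm, 'v) vect_functor \<Rightarrow> 'o \<Rightarrow> 'o \<Rightarrow> 'm \<Rightarrow> bool" where
  "subobject C F X Y i \<longleftrightarrow> i \<in> hom C Y X \<and> inj_on (Mp F i) (Sp F Y)"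

definition underlying :: "('k, 'o, 'm, 'v) vect_functor \<Rightarrow> 'o \<Rightarrow> 'm \<Rightarrow> 'v set" where
  "underlying F Y i = Mp F i ` Sp F Y"

text \<open>
  A set \<open>A\<close> of elements of \<open>F(X)\<close> regarded as an object of \<open>C\<close>: the largest subobject of \<open>X\<close> whose
  elements lie in \<open>A\<close>. If \<open>A\<close> carries a subobject of \<open>X\<close> at all, then the elements of the largest
  one are exactly those of \<open>A\<close> (lemma \<open>subobject_on_underlying\<close>). Being largest equips \<open>A\<close> with the
  structure it inherits from \<open>X\<close>, rather than with some other object structure on the same vector
  space, and determines the object up to isomorphism.
\<close>

definition subobject_on ::
    "('o, 'm) tensor_cat \<Rightarrow> ('k, 'o, 'm, 'v) vect_functor \<Rightarrow> 'o \<Rightarrow> 'v set \<Rightarrow> 'o \<Rightarrow> 'm \<Rightarrow> bool" where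
  "subobject_on C F X A J i \<longleftrightarrow>
     subobject C F X J i \<and> underlying F J i \<subseteq> A \<and>
     (\<forall>Y y. subobject C F X Y y \<and> underlying F Y y \<subseteq> A \<longrightarrow> (\<exists>z \<in> hom C Y J. i \<cdot>\<^bsub>C\<^esub> z = y))"

lemma (in forgetful_functor) subobject_on_underlying:
  assumes J: "subobject_on C F X A J i"
    and Y: "subobject C F X Y y" "underlying F Y y = A"
  shows "underlying F J i = A"
proof
  show "underlying F J i \<subseteq> A"
    using J by (simp add: subobject_on_def)
  obtain z where z: "z \<in> hom C Y J" "i \<cdot> z = y"
    using J Y unfolding subobject_on_def by blast
  have i: "i \<in> hom C J X"
    using J by (simp add: subobject_on_def subobject_def)
  have "Mp F y u = Mp F i (Mp F z u)" if "u \<in> Sp F Y" for u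
    using Mp_comp[OF z(1) i that] z(2) by simp
  moreover have "Mp F z u \<in> Sp F J" if "u \<in> Sp F Y" for u
    using Mp_linear[OF z(1)] that by (auto simp: linear_on_def)
  ultimately have "underlying F Y y \<subseteq> underlying F J i"
    by (auto simp: underlying_def)
  then show "A \<subseteq> underlying F J i"
    using Y(2) by simp
qed


section \<open>Algebraic structures in the category\<close>

locale algebra_in =
  fixes C :: "('o, 'm) tensor_cat" (structure) and A :: 'o and m \<eta> :: 'm
  assumes mult_hom: "m \<in> hom C (A \<boxtimes> A) A"
    and unit_hom: "\<eta> \<in> hom C \<I> A"
    and mult_assoc: "m \<cdot> (m \<otimes> \<one> A) = m \<cdot> (\<one> A \<otimes> m)"
    and mult_unit: "m \<cdot> (\<eta> \<otimes> \<one> A) = \<one> A" "m \<cdot> (\<one> A \<otimes> \<eta>) = \<one> A"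

locale coalgebra_in =
  fixes C :: "('o, 'm) tensor_cat" (structure) and A :: 'o and \<Delta> \<epsilon> :: 'm
  assumes comult_hom: "\<Delta> \<in> hom C A (A \<boxtimes> A)"
    and counit_hom: "\<epsilon> \<in> hom C A \<I>"
    and comult_coassoc: "(\<Delta> \<otimes> \<one> A) \<cdot> \<Delta> = (\<one> A \<otimes> \<Delta>) \<cdot> \<Delta>"
    and comult_counit: "(\<epsilon> \<otimes> \<one> A) \<cdot> \<Delta> = \<one> A" "(\<one> A \<otimes> \<epsilon>) \<cdot> \<Delta> = \<one> A"

locale braided_hopf_algebra =
  algebra_in C H m \<eta> + coalgebra_in C H \<Delta> \<epsilon>
  for C :: "('o, 'm) tensor_cat" (structure) and H :: 'o and m \<eta> \<Delta> \<epsilon> S :: 'm +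
  assumes comult_mult: "\<Delta> \<cdot> m = (m \<otimes> m) \<cdot> (\<one> H \<otimes> \<sigma> H H \<otimes> \<one> H) \<cdot> (\<Delta> \<otimes> \<Delta>)"
    and comult_unit: "\<Delta> \<cdot> \<eta> = \<eta> \<otimes> \<eta>"
    and counit_mult: "\<epsilon> \<cdot> m = \<epsilon> \<otimes> \<epsilon>"
    and counit_unit: "\<epsilon> \<cdot> \<eta> = \<one> \<I>"
    and antipode_hom: "S \<in> hom C H H"
    and antipode: "m \<cdot> (S \<otimes> \<one> H) \<cdot> \<Delta> = \<eta> \<cdot> \<epsilon>" "m \<cdot> (\<one> H \<otimes> S) \<cdot> \<Delta> = \<eta> \<cdot> \<epsilon>"

locale left_module_in =
  fixes C :: "('o, 'm) tensor_cat" (structure) and A :: 'o and m \<eta> :: 'm and M :: 'o and \<alpha> :: 'm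
  assumes action_hom: "\<alpha> \<in> hom C (A \<boxtimes> M) M"
    and action_mult: "\<alpha> \<cdot> (m \<otimes> \<one> M) = \<alpha> \<cdot> (\<one> A \<otimes> \<alpha>)"
    and action_unit: "\<alpha> \<cdot> (\<eta> \<otimes> \<one> M) = \<one> M"

locale right_module_in =
  fixes C :: "('o, 'm) tensor_cat" (structure) and A :: 'o and m \<eta> :: 'm and M :: 'o and \<alpha> :: 'm
  assumes action_hom: "\<alpha> \<in> hom C (M \<boxtimes> A) M"
    and action_mult: "\<alpha> \<cdot> (\<one> M \<otimes> m) = \<alpha> \<cdot> (\<alpha> \<otimes> \<one> A)"
    and action_unit: "\<alpha> \<cdot> (\<one> M \<otimes> \<eta>) = \<one> M"

locale right_comodule_in =
  fixes C :: "('o, 'm) tensor_cat" (structure) and A :: 'o and \<Delta> \<epsilon> :: 'm and M :: 'o and \<rho> :: 'm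
  assumes coaction_hom: "\<rho> \<in> hom C M (M \<boxtimes> A)"
    and coaction_comult: "(\<one> M \<otimes> \<Delta>) \<cdot> \<rho> = (\<rho> \<otimes> \<one> A) \<cdot> \<rho>"
    and coaction_counit: "(\<one> M \<otimes> \<epsilon>) \<cdot> \<rho> = \<one> M"

locale hopf_module =
  right_module_in C H m \<eta> M \<alpha> + right_comodule_in C H \<Delta> \<epsilon> M \<rho>
  for C :: "('o, 'm) tensor_cat" (structure) and H :: 'o and m \<eta> \<Delta> \<epsilon> :: 'm
    and M :: 'o and \<alpha> \<rho> :: 'm +
  assumes coaction_action: "\<rho> \<cdot> \<alpha> = (\<alpha> \<otimes> m) \<cdot> (\<one> M \<otimes> \<sigma> H H \<otimes> \<one> H) \<cdot> (\<rho> \<otimes> \<Delta>)"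

locale hopf_module_iso =
  M: hopf_module C H m \<eta> \<Delta> \<epsilon> M \<alpha> \<rho> + M': hopf_module C H m \<eta> \<Delta> \<epsilon> M' \<alpha>' \<rho>'
  for C :: "('o, 'm) tensor_cat" (structure) and H :: 'o and m \<eta> \<Delta> \<epsilon> :: 'm
    and M :: 'o and \<alpha> \<rho> :: 'm and M' :: 'o and \<alpha>' \<rho>' \<phi> :: 'm +
  assumes hom: "\<phi> \<in> hom C M M'"
    and iso: "iso_mor C \<phi>"
    and action: "\<phi> \<cdot> \<alpha> = \<alpha>' \<cdot> (\<phi> \<otimes> \<one> H)"
    and coaction: "\<rho>' \<cdot> \<phi> = (\<phi> \<otimes> \<one> H) \<cdot> \<rho>"

definition hopf_modules_isomorphic where
  "hopf_modules_isomorphic C H m \<eta> \<Delta> \<epsilon> M \<alpha> \<rho> M' \<alpha>' \<rho>' \<longleftrightarrow>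
     (\<exists>\<phi>. hopf_module_iso C H m \<eta> \<Delta> \<epsilon> M \<alpha> \<rho> M' \<alpha>' \<rho>' \<phi>)"


section \<open>Quasi-duals, rational modules and integrals\<close>

locale left_quasi_dual =
  algebra_in C N mN \<eta>N
  for C :: "('o, 'm) tensor_cat" (structure) and H :: 'o and \<Delta> \<epsilon> :: 'm
    and N :: 'o and mN \<eta>N ev :: 'm +
  assumes ev_hom: "ev \<in> hom C (N \<boxtimes> H) \<I>"
    and ev_mult:
      "ev \<cdot> (mN \<otimes> \<one> H) = (ev \<otimes> ev) \<cdot> (\<one> N \<otimes> \<sigma> N H \<otimes> \<one> H) \<cdot> (\<one> N \<otimes> \<one> N \<otimes> \<Delta>)"
    and ev_unit: "ev \<cdot> (\<eta>N \<otimes> \<one> H) = \<epsilon>"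

locale faithful_quasi_dual =
  left_quasi_dual C H \<Delta> \<epsilon> N mN \<eta>N ev
  for C :: "('o, 'm) tensor_cat" (structure) and H :: 'o and \<Delta> \<epsilon> :: 'm
    and N :: 'o and mN \<eta>N ev :: 'm +
  assumes faithful_dual:
      "\<lbrakk>f \<in> hom C U (V \<boxtimes> N); f' \<in> hom C U (V \<boxtimes> N);
        (\<one> V \<otimes> ev) \<cdot> (f \<otimes> \<one> H) = (\<one> V \<otimes> ev) \<cdot> (f' \<otimes> \<one> H)\<rbrakk> \<Longrightarrow> f = f'"
    and faithful_H:
      "\<lbrakk>g \<in> hom C U (H \<boxtimes> V); g' \<in> hom C U (H \<boxtimes> V);
        (ev \<otimes> \<one> V) \<cdot> (\<one> N \<otimes> g) = (ev \<otimes> \<one> V) \<cdot> (\<one> N \<otimes> g')\<rbrakk> \<Longrightarrow> g = g'"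

text \<open>The value \<open>f(h)\<close> of an element \<open>f\<close> of \<open>N\<close> at an element \<open>h\<close> of \<open>H\<close>.\<close>

definition ev_at ::
    "('k, 'o, 'm, 'v) vect_functor \<Rightarrow> 'o \<Rightarrow> 'o \<Rightarrow> 'm \<Rightarrow> 'v \<Rightarrow> 'v \<Rightarrow> 'k" where
  "ev_at F N H ev f h = to_scalar F (Mp F ev (Tens F N H f h))"

text \<open>
  \<open>N\<close> is contained in the dual space of \<open>H\<close>, with \<open>ev\<close> the evaluation: an element of \<open>N\<close> is identified
  with the linear form on \<open>H\<close> that it defines.
\<close>

definition embedded_in_dual ::
    "('k, 'o, 'm, 'v) vect_functor \<Rightarrow> 'o \<Rightarrow> 'o \<Rightarrow> 'm \<Rightarrow> bool" where
  "embedded_in_dual F N H ev \<longleftrightarrow>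
     (\<forall>f \<in> Sp F N. \<forall>f' \<in> Sp F N.
        (\<forall>h \<in> Sp F H. ev_at F N H ev f h = ev_at F N H ev f' h) \<longrightarrow> f = f')"

definition rational_coaction ::
    "('o, 'm) tensor_cat \<Rightarrow> 'o \<Rightarrow> 'o \<Rightarrow> 'm \<Rightarrow> 'o \<Rightarrow> 'm \<Rightarrow> 'm \<Rightarrow> bool" where
  "rational_coaction C H N ev M \<alpha> \<rho> \<longleftrightarrow>
     \<rho> \<in> hom C M (M \<boxtimes>\<^bsub>C\<^esub> H) \<and>
     (\<one>\<^bsub>C\<^esub> M \<otimes>\<^bsub>C\<^esub> ev) \<cdot>\<^bsub>C\<^esub> (\<sigma>\<^bsub>C\<^esub> N M \<otimes>\<^bsub>C\<^esub> \<one>\<^bsub>C\<^esub> H) \<cdot>\<^bsub>C\<^esub> (\<one>\<^bsub>C\<^esub> N \<otimes>\<^bsub>C\<^esub> \<rho>) = \<alpha>"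

definition rational_submodule ::
    "('o, 'm) tensor_cat \<Rightarrow> ('k, 'o, 'm, 'v) vect_functor \<Rightarrow> 'o \<Rightarrow> 'o \<Rightarrow> 'm \<Rightarrow> 'm \<Rightarrow> 'm \<Rightarrow>
     'o \<Rightarrow> 'm \<Rightarrow> 'm \<Rightarrow> bool" where
  "rational_submodule C F H N mN \<eta>N ev M \<alpha> j \<longleftrightarrow>
     left_module_in C N mN \<eta>N M \<alpha> \<and> (\<exists>\<rho>. rational_coaction C H N ev M \<alpha> \<rho>) \<and>
     subobject C F N M j \<and> j \<cdot>\<^bsub>C\<^esub> \<alpha> = mN \<cdot>\<^bsub>C\<^esub> (\<one>\<^bsub>C\<^esub> N \<otimes>\<^bsub>C\<^esub> j)"

definition maximal_rational_submodule ::
    "('o, 'm) tensor_cat \<Rightarrow> ('k, 'o, 'm, 'v) vect_functor \<Rightarrow> 'o \<Rightarrow> 'o \<Rightarrow> 'm \<Rightarrow> 'm \<Rightarrow> 'm \<Rightarrow>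
     'o \<Rightarrow> 'm \<Rightarrow> 'm \<Rightarrow> bool" where
  "maximal_rational_submodule C F H N mN \<eta>N ev M \<alpha> j \<longleftrightarrow>
     rational_submodule C F H N mN \<eta>N ev M \<alpha> j \<and>
     (\<forall>M' \<alpha>' j'. rational_submodule C F H N mN \<eta>N ev M' \<alpha>' j' \<longrightarrow>
        (\<exists>y \<in> hom C M' M. j \<cdot>\<^bsub>C\<^esub> y = j'))"

text \<open>
  The scalar \<open>g(1)\<close> is the value of \<open>g\<close> at the unit element \<open>Mp F \<eta> (One F)\<close> of \<open>H\<close>. As an object of
  \<open>C\<close>, the integrals are the subobject of \<open>N\<close> given by \<open>subobject_on\<close>. In general that subobject
  may miss integrals: let \<open>G\<close> be the group of finitely supported sequences of integers, let the
  free monoid on one generator act on \<open>k[G]\<close> by the right shift and on the functions on \<open>G\<close> by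
  composition with the left shift. In its category of representations, the integrals in the dual
  of \<open>k[G]\<close> are the multiples of the indicator function of \<open>0\<close>, which span no subrepresentation,
  and \<open>0\<close> is the only rational submodule.
\<close>

definition left_integrals ::
    "('k, 'o, 'm, 'v) vect_functor \<Rightarrow> 'o \<Rightarrow> 'm \<Rightarrow> 'o \<Rightarrow> 'm \<Rightarrow> 'm \<Rightarrow> 'v set" where
  "left_integrals F H \<eta> N mN ev =
     {f \<in> Sp F N. \<forall>g \<in> Sp F N.
        Mp F mN (Tens F N N g f) = Smult F (ev_at F N H ev g (Mp F \<eta> (One F))) f}"

definition is_harpoon ::
    "('o, 'm) tensor_cat \<Rightarrow> 'o \<Rightarrow> 'm \<Rightarrow> 'o \<Rightarrow> 'm \<Rightarrow> 'm \<Rightarrow> bool" where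
  "is_harpoon C H m N ev a \<longleftrightarrow>
     a \<in> hom C (H \<boxtimes>\<^bsub>C\<^esub> N) N \<and>
     ev \<cdot>\<^bsub>C\<^esub> (a \<otimes>\<^bsub>C\<^esub> \<one>\<^bsub>C\<^esub> H) =
       ev \<cdot>\<^bsub>C\<^esub> (\<one>\<^bsub>C\<^esub> N \<otimes>\<^bsub>C\<^esub> m) \<cdot>\<^bsub>C\<^esub> (\<one>\<^bsub>C\<^esub> N \<otimes>\<^bsub>C\<^esub> \<sigma>\<^bsub>C\<^esub> H H) \<cdot>\<^bsub>C\<^esub> (\<sigma>\<^bsub>C\<^esub> H N \<otimes>\<^bsub>C\<^esub> \<one>\<^bsub>C\<^esub> H)"

end

theory Submission
  imports Defs
begin

text \<open>
  For a Hopf module \<open>M\<close>, the morphism \<open>P(x) = x\<^sub>0 S(x\<^sub>1)\<close> is idempotent with image the coinvariants,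
  and an equalizer of \<open>P\<close> and the identity splits it as \<open>M \<rightarrow> J \<rightarrow> M\<close>; this gives \<open>M \<cong> J \<otimes> H\<close> without
  assuming that the tensor product preserves equalizers.

  For the rational part of the dual, the coinvariants are the integrals: an action determines its
  rational coaction, and \<open>x \<mapsto> x \<otimes> 1\<close> is the coaction belonging to the trivial action \<open>g(1) x\<close>.
  Moreover a subobject of the dual consisting of integrals is a rational submodule with the trivial
  action, so it lies in the maximal one. It remains to see that the rational part is a Hopf module. In
  elements, \<open>(f \<leftharpoondown> h)(x) = f(x S(h))\<close>, and testing the compatibility condition against \<open>g\<close> and \<open>x\<close>
  reduces it to the identity \<open>x\<^sub>1 \<otimes> x\<^sub>2 S(h) = (x S(h\<^sub>1))\<^sub>1 h\<^sub>2 \<otimes> (x S(h\<^sub>1))\<^sub>2\<close> in \<open>H\<close>. Identities of this kind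
  are proved by multiplying both sides by a further component of \<open>h\<close>, an operation which the antipode inverts.
  The braiding between \<open>H\<close> and its dual is symmetric because that of \<open>H\<close> is and the pairing is faithful.
\<close>

section \<open>Calculus in strict braided tensor categories\<close>

context braided_tensor_category
begin

lemma homD: "f \<in> hom C A B \<Longrightarrow> Source C f = A" "f \<in> hom C A B \<Longrightarrow> Target C f = B"
  by (simp_all add: hom_def)

lemma hom_iff: "f \<in> hom C A B \<longleftrightarrow> Source C f = A \<and> Target C f = B"
  by (simp add: hom_def)

lemma in_hom_self: "f \<in> hom C (Source C f) (Target C f)"
  by (simp add: hom_def)

lemma ends_simps [simp]:
  "Source C (\<one> A) = A" "Target C (\<one> A) = A"
  "Source C (f \<otimes> g) = Source C f \<boxtimes> Source C g" "Target C (f \<otimes> g) = Target C f \<boxtimes> Target C g"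
  "Source C (\<sigma> A B) = A \<boxtimes> B" "Target C (\<sigma> A B) = B \<boxtimes> A"
  using ident_hom[of A] tens_hom[OF in_hom_self in_hom_self, of f g] braid_hom[of A B]
  by (simp_all add: hom_def)

lemma ends_comp [simp]:
  assumes "Target C f = Source C g"
  shows "Source C (g \<cdot> f) = Source C f" "Target C (g \<cdot> f) = Target C g"
  using comp_hom[of f "Source C f" "Target C f" g "Target C g"] assms by (simp_all add: hom_def)

lemmas obj_simps [simp] = tensO_assoc tensO_unit

lemma compose_assoc [simp]:
  assumes "Target C f = Source C g" "Target C g = Source C h"
  shows "(h \<cdot> g) \<cdot> f = h \<cdot> (g \<cdot> f)"
  using comp_assoc[of f "Source C f" "Target C f" g "Target C g" h "Target C h"] assms
  by (simp add: hom_def)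

lemma compose_id [simp]:
  "Source C f = A \<Longrightarrow> f \<cdot> \<one> A = f"
  "Target C f = A \<Longrightarrow> \<one> A \<cdot> f = f"
  using comp_ident_right[of f A "Target C f"] comp_ident_left[of f "Source C f" A]
  by (simp_all add: hom_def)

lemma unit_simps [simp]: "\<one> \<I> \<otimes> f = f" "f \<otimes> \<one> \<I> = f" "\<one> A \<otimes> \<one> B = \<one> (A \<boxtimes> B)"
  by (simp_all add: tensM_unit tens_ident)

lemma interchange:
  assumes "Target C f = Source C g" "Target C f' = Source C g'"
  shows "(g \<otimes> g') \<cdot> (f \<otimes> f') = (g \<cdot> f) \<otimes> (g' \<cdot> f')"
  using tens_comp[of f "Source C f" "Target C f" g "Target C g" f' "Source C f'" "Target C f'" g' "Target C g'"]
    assms by (simp add: hom_def)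

text \<open>Composites are kept nested to the right, so two layers to be merged are usually followed
  by a further composite; the \<open>_tail\<close> variants of an equation act in that
  position.\<close>

lemma interchange_tail:
  assumes "Target C f = Source C g" "Target C f' = Source C g'" "Target C x = Source C f \<boxtimes> Source C f'"
  shows "(g \<otimes> g') \<cdot> ((f \<otimes> f') \<cdot> x) = ((g \<cdot> f) \<otimes> (g' \<cdot> f')) \<cdot> x"
  using assms by (subst compose_assoc[symmetric]) (simp_all add: interchange)

lemma comp_tail:
  assumes "a \<cdot> b = c" "Target C b = Source C a" "Target C x = Source C b"
  shows "a \<cdot> (b \<cdot> x) = c \<cdot> x"
  using assms by (subst compose_assoc[symmetric]) simp_all

lemma braid_nat: 
  assumes "Source C f = A" "Source C g = B" "Target C f = A'" "Target C g = B'"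
  shows "\<sigma> A' B' \<cdot> (f \<otimes> g) = (g \<otimes> f) \<cdot> \<sigma> A B"
  using braid_natural[of f A A' g B B'] assms by (simp add: hom_def)

lemma comp_eq_tail:
  assumes "a \<cdot> b = c \<cdot> d" "Target C b = Source C a" "Target C d = Source C c" "Target C x = Source C b"
    "Source C d = Source C b"
  shows "a \<cdot> (b \<cdot> x) = c \<cdot> (d \<cdot> x)"
  using assms by (metis compose_assoc)

lemma braid_nat_tail:
  assumes "Source C f = A" "Source C g = B" "Target C f = A'" "Target C g = B'" "Target C x = A \<boxtimes> B"
  shows "\<sigma> A' B' \<cdot> ((f \<otimes> g) \<cdot> x) = (g \<otimes> f) \<cdot> (\<sigma> A B \<cdot> x)"
  using assms by (intro comp_eq_tail braid_nat) simp_all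

lemma iso_mor_cancel:
  assumes "iso_mor C f" "f \<cdot> x = f \<cdot> y" "Target C x = Source C f" "Target C y = Source C f"
  shows "x = y"
proof -
  obtain g where g: "inverse_of C f g" using assms(1) by (auto simp: iso_mor_def)
  then have [simp]: "Source C g = Target C f" "Target C g = Source C f" and gf: "g \<cdot> f = \<one> (Source C f)"
    by (auto simp: inverse_of_def hom_def)
  have "g \<cdot> (f \<cdot> x) = x" "g \<cdot> (f \<cdot> y) = y"
    using assms(3,4) comp_tail[OF gf] by simp_all
  then show ?thesis using assms(2) by metis
qed

text \<open>A hexagon with two unit objects makes this braiding idempotent, and an invertible
  idempotent is an identity.\<close>

lemma braid_unit [simp]: "\<sigma> \<I> A = \<one> A" "\<sigma> A \<I> = \<one> A"
proof -
  have "\<sigma> \<I> A \<cdot> \<sigma> \<I> A = \<sigma> \<I> A \<cdot> \<one> A"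
    using hexagon_left[of \<I> \<I> A] by simp
  then show "\<sigma> \<I> A = \<one> A"
    using iso_mor_cancel[OF braid_iso] by fastforce
  have "\<sigma> A \<I> \<cdot> \<sigma> A \<I> = \<sigma> A \<I> \<cdot> \<one> A"
    using hexagon_right[of A \<I> \<I>] by simp
  then show "\<sigma> A \<I> = \<one> A"
    using iso_mor_cancel[OF braid_iso] by fastforce
qed

lemma braid_inverse:
  obtains b where "Source C b = B \<boxtimes> A" "Target C b = A \<boxtimes> B"
    "b \<cdot> \<sigma> A B = \<one> (A \<boxtimes> B)" "\<sigma> A B \<cdot> b = \<one> (B \<boxtimes> A)"
proof -
  obtain b where "inverse_of C (\<sigma> A B) b" using braid_iso[of A B] by (auto simp: iso_mor_def)
  then show ?thesis by (intro that[of b]) (auto simp: inverse_of_def hom_def)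
qed

lemmas interchanges = interchange interchange_tail

lemmas split_idents = tens_ident[symmetric] tensM_assoc

text \<open>The direction opposite to \<open>interchange\<close>: a composite is spread over layers
  that apply one morphism each. With \<open>split_idents\<close>, identities of tensor products are
  split as well, which \<open>unit_simps(3)\<close> would undo.\<close>

lemma whisker:
  assumes "Target C f = Source C g"
  shows "(g \<cdot> f) \<otimes> \<one> A = (g \<otimes> \<one> A) \<cdot> (f \<otimes> \<one> A)" "\<one> A \<otimes> (g \<cdot> f) = (\<one> A \<otimes> g) \<cdot> (\<one> A \<otimes> f)"
    "(g \<cdot> f) \<otimes> \<one> A \<otimes> \<one> B = (g \<otimes> \<one> A \<otimes> \<one> B) \<cdot> (f \<otimes> \<one> A \<otimes> \<one> B)"
  using assms by (simp_all add: interchange)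

lemmas layers = whisker split_idents

end

section \<open>Convolution and the antipode\<close>

locale symmetric_hopf_algebra =
  braided_tensor_category C + braided_hopf_algebra C H m \<eta> \<Delta> \<epsilon> S
  for C :: "('o, 'm) tensor_cat" (structure) and H :: 'o and m \<eta> \<Delta> \<epsilon> S :: 'm +
  assumes braid_HH: "\<sigma> H H \<cdot> \<sigma> H H = \<one> (H \<boxtimes> H)"
begin

lemmas structure_ends [simp] =
  homD[OF mult_hom] homD[OF unit_hom] homD[OF comult_hom] homD[OF counit_hom] homD[OF antipode_hom]

abbreviation hmodule where "hmodule M \<beta> \<equiv> right_module_in C H m \<eta> M \<beta>"
abbreviation hcomodule where "hcomodule W \<rho> \<equiv> right_comodule_in C H \<Delta> \<epsilon> W \<rho>"

lemma hmodule_ends: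
  assumes "hmodule M \<beta>" shows "Source C \<beta> = M \<boxtimes> H" "Target C \<beta> = M"
  using homD[OF right_module_in.action_hom[OF assms]] by simp_all

lemma hcomodule_ends:
  assumes "hcomodule W \<rho>" shows "Source C \<rho> = W" "Target C \<rho> = W \<boxtimes> H"
  using homD[OF right_comodule_in.coaction_hom[OF assms]] by simp_all

text \<open>The expression \<open>\<beta> \<cdot> (f \<otimes> \<phi>) \<cdot> \<rho>\<close> is the
  convolution of \<open>f\<close> with an endomorphism of \<open>H\<close>. Associativity of the
  action and coassociativity of the coaction move the brackets.\<close>

lemma conv_assoc:
  assumes M: "hmodule M \<beta>" and W: "hcomodule W \<rho>"
    and [simp]: "Source C f = W" "Target C f = M"
      "Source C \<phi> = H" "Target C \<phi> = H" "Source C \<psi> = H" "Target C \<psi> = H"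
  shows "\<beta> \<cdot> ((\<beta> \<cdot> (f \<otimes> \<phi>) \<cdot> \<rho>) \<otimes> \<psi>) \<cdot> \<rho> = \<beta> \<cdot> (f \<otimes> (m \<cdot> (\<phi> \<otimes> \<psi>) \<cdot> \<Delta>)) \<cdot> \<rho>"
proof -
  note [simp] = hmodule_ends[OF M] hcomodule_ends[OF W]
  have "\<beta> \<cdot> ((\<beta> \<cdot> (f \<otimes> \<phi>) \<cdot> \<rho>) \<otimes> \<psi>) \<cdot> \<rho>
      = (\<beta> \<cdot> (\<beta> \<otimes> \<one> H)) \<cdot> ((f \<otimes> \<phi>) \<otimes> \<psi>) \<cdot> ((\<rho> \<otimes> \<one> H) \<cdot> \<rho>)"
    by (simp add: interchanges)
  also have "\<dots> = (\<beta> \<cdot> (\<one> M \<otimes> m)) \<cdot> (f \<otimes> (\<phi> \<otimes> \<psi>)) \<cdot> ((\<one> W \<otimes> \<Delta>) \<cdot> \<rho>)"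
    using right_module_in.action_mult[OF M] right_comodule_in.coaction_comult[OF W]
    by (simp only: tensM_assoc)
  also have "\<dots> = \<beta> \<cdot> (f \<otimes> (m \<cdot> (\<phi> \<otimes> \<psi>) \<cdot> \<Delta>)) \<cdot> \<rho>"
    by (simp add: interchanges)
  finally show ?thesis .
qed

lemma conv_unit:
  assumes M: "hmodule M \<beta>" and W: "hcomodule W \<rho>" and [simp]: "Source C f = W" "Target C f = M"
  shows "\<beta> \<cdot> (f \<otimes> (\<eta> \<cdot> \<epsilon>)) \<cdot> \<rho> = f"
proof -
  note [simp] = hmodule_ends[OF M] hcomodule_ends[OF W]
  have "\<beta> \<cdot> (f \<otimes> (\<eta> \<cdot> \<epsilon>)) \<cdot> \<rho> = (\<beta> \<cdot> (\<one> M \<otimes> \<eta>)) \<cdot> (f \<otimes> \<one> \<I>) \<cdot> ((\<one> W \<otimes> \<epsilon>) \<cdot> \<rho>)"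
    by (simp add: interchanges del: unit_simps(2))
  also have "\<dots> = f"
    using right_module_in.action_unit[OF M] right_comodule_in.coaction_counit[OF W] by simp
  finally show ?thesis .
qed

text \<open>Convolution with the identity of \<open>H\<close> is undone by convolution with
  \<open>S\<close>, as the two convolve to the unit \<open>\<eta> \<cdot> \<epsilon>\<close>. Thus a
  further component may be multiplied onto both sides of an identity and removed again.\<close>

lemma conv_cancel:
  assumes M: "hmodule M \<beta>" and W: "hcomodule W \<rho>"
    and f: "Source C f = W" "Target C f = M" and g: "Source C g = W" "Target C g = M"
    and eq: "\<beta> \<cdot> (f \<otimes> \<one> H) \<cdot> \<rho> = \<beta> \<cdot> (g \<otimes> \<one> H) \<cdot> \<rho>"
  shows "f = g"
proof -
  have *: "\<beta> \<cdot> ((\<beta> \<cdot> (h \<otimes> \<one> H) \<cdot> \<rho>) \<otimes> S) \<cdot> \<rho> = h" if "Source C h = W" "Target C h = M" for h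
    using conv_assoc[OF M W, of h "\<one> H" S] conv_unit[OF M W] that antipode(2) by simp
  show ?thesis using *[OF f] *[OF g] unfolding eq by (rule trans[OF sym])
qed

section \<open>Free modules and comodules, and structures extended past a further tensor
  factor\<close>

lemma free_hmodule: "hmodule (V \<boxtimes> H) (\<one> V \<otimes> m)"
proof
  show "\<one> V \<otimes> m \<in> hom C ((V \<boxtimes> H) \<boxtimes> H) (V \<boxtimes> H)"
    by (simp add: hom_iff)
  have "(\<one> V \<otimes> m) \<cdot> (\<one> V \<otimes> \<one> H \<otimes> m) = (\<one> V \<otimes> m) \<cdot> (\<one> V \<otimes> m \<otimes> \<one> H)"
    by (simp add: interchanges mult_assoc)
  then show "(\<one> V \<otimes> m) \<cdot> (\<one> (V \<boxtimes> H) \<otimes> m) = (\<one> V \<otimes> m) \<cdot> ((\<one> V \<otimes> m) \<otimes> \<one> H)"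
    by (simp only: tens_ident[symmetric] tensM_assoc)
  have "(\<one> V \<otimes> m) \<cdot> (\<one> V \<otimes> \<one> H \<otimes> \<eta>) = \<one> (V \<boxtimes> H)"
    by (simp add: interchanges mult_unit)
  then show "(\<one> V \<otimes> m) \<cdot> (\<one> (V \<boxtimes> H) \<otimes> \<eta>) = \<one> (V \<boxtimes> H)"
    by (simp only: tens_ident[symmetric] tensM_assoc)
qed

lemma free_hcomodule: "hcomodule (V \<boxtimes> H) (\<one> V \<otimes> \<Delta>)"
proof
  show "\<one> V \<otimes> \<Delta> \<in> hom C (V \<boxtimes> H) ((V \<boxtimes> H) \<boxtimes> H)"
    by (simp add: hom_iff)
  have "(\<one> V \<otimes> \<one> H \<otimes> \<Delta>) \<cdot> (\<one> V \<otimes> \<Delta>) = (\<one> V \<otimes> \<Delta> \<otimes> \<one> H) \<cdot> (\<one> V \<otimes> \<Delta>)"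
    by (simp add: interchanges comult_coassoc)
  then show "(\<one> (V \<boxtimes> H) \<otimes> \<Delta>) \<cdot> (\<one> V \<otimes> \<Delta>) = ((\<one> V \<otimes> \<Delta>) \<otimes> \<one> H) \<cdot> (\<one> V \<otimes> \<Delta>)"
    by (simp only: tens_ident[symmetric] tensM_assoc)
  have "(\<one> V \<otimes> \<one> H \<otimes> \<epsilon>) \<cdot> (\<one> V \<otimes> \<Delta>) = \<one> (V \<boxtimes> H)"
    by (simp add: interchanges comult_counit)
  then show "(\<one> (V \<boxtimes> H) \<otimes> \<epsilon>) \<cdot> (\<one> V \<otimes> \<Delta>) = \<one> (V \<boxtimes> H)"
    by (simp only: tens_ident[symmetric] tensM_assoc)
qed

text \<open>The \<open>H\<close> component passes \<open>V\<close> through the braiding; hexagon and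
  naturality reduce the axioms to those of \<open>W\<close>. The case \<open>V = H\<close> allows
  convolution along the first of two factors \<open>H\<close>.\<close>

lemma tensor_hcomodule:
  assumes W: "hcomodule W \<rho>"
  shows "hcomodule (W \<boxtimes> V) ((\<one> W \<otimes> \<sigma> H V) \<cdot> (\<rho> \<otimes> \<one> V))"
proof
  note [simp] = hcomodule_ends[OF W]
  let ?r = "(\<one> W \<otimes> \<sigma> H V) \<cdot> (\<rho> \<otimes> \<one> V)"
  show "?r \<in> hom C (W \<boxtimes> V) ((W \<boxtimes> V) \<boxtimes> H)"
    by (simp add: hom_iff)
  have "(\<one> (W \<boxtimes> V) \<otimes> \<Delta>) \<cdot> ?r = (\<one> W \<otimes> ((\<one> V \<otimes> \<Delta>) \<cdot> \<sigma> H V)) \<cdot> (\<rho> \<otimes> \<one> V)"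
    by (simp only: tens_ident[symmetric] tensM_assoc) (simp add: interchanges)
  also have "\<dots> = (\<one> W \<otimes> (\<sigma> (H \<boxtimes> H) V \<cdot> (\<Delta> \<otimes> \<one> V))) \<cdot> (\<rho> \<otimes> \<one> V)"
    by (simp add: braid_nat)
  also have "\<dots> = (\<one> W \<otimes> \<sigma> (H \<boxtimes> H) V) \<cdot> (\<one> W \<otimes> \<Delta> \<otimes> \<one> V) \<cdot> (\<rho> \<otimes> \<one> V)"
    by (simp add: interchanges)
  also have "\<dots> = (\<one> W \<otimes> \<sigma> (H \<boxtimes> H) V) \<cdot> (((\<one> W \<otimes> \<Delta>) \<cdot> \<rho>) \<otimes> \<one> V)"
    by (simp only: tensM_assoc[symmetric]) (simp add: interchanges)
  also have "\<dots> = (\<one> W \<otimes> \<sigma> H V \<otimes> \<one> H) \<cdot> (\<one> W \<otimes> \<one> H \<otimes> \<sigma> H V) \<cdot> (((\<rho> \<otimes> \<one> H) \<cdot> \<rho>) \<otimes> \<one> V)"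
    using right_comodule_in.coaction_comult[OF W] by (simp add: interchanges hexagon_left)
  also have "\<dots> = ((\<one> W \<otimes> \<sigma> H V) \<otimes> \<one> H) \<cdot> ((\<one> W \<otimes> \<one> H) \<otimes> \<sigma> H V) \<cdot> (\<rho> \<otimes> \<one> (H \<boxtimes> V)) \<cdot> (\<rho> \<otimes> \<one> V)"
    by (simp only: tensM_assoc tens_ident[symmetric]) (simp add: interchanges tensM_assoc[symmetric] del: unit_simps(3))
  also have "\<dots> = ((\<one> W \<otimes> \<sigma> H V) \<otimes> \<one> H) \<cdot> (\<rho> \<otimes> \<one> (V \<boxtimes> H)) \<cdot> (\<one> W \<otimes> \<sigma> H V) \<cdot> (\<rho> \<otimes> \<one> V)"
    by (simp add: interchanges)
  also have "\<dots> = (?r \<otimes> \<one> H) \<cdot> ?r"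
    by (simp only: tensM_assoc tens_ident[symmetric]) (simp add: interchanges tensM_assoc[symmetric] del: unit_simps(3))
  finally show "(\<one> (W \<boxtimes> V) \<otimes> \<Delta>) \<cdot> ?r = (?r \<otimes> \<one> H) \<cdot> ?r" .
  have "(\<one> (W \<boxtimes> V) \<otimes> \<epsilon>) \<cdot> ?r = (\<one> W \<otimes> ((\<one> V \<otimes> \<epsilon>) \<cdot> \<sigma> H V)) \<cdot> (\<rho> \<otimes> \<one> V)"
    by (simp only: tens_ident[symmetric] tensM_assoc) (simp add: interchanges)
  also have "\<dots> = (\<one> W \<otimes> \<epsilon> \<otimes> \<one> V) \<cdot> (\<rho> \<otimes> \<one> V)"
    using braid_nat[of \<epsilon> H "\<one> V" V \<I> V] by simp
  also have "\<dots> = ((\<one> W \<otimes> \<epsilon>) \<cdot> \<rho>) \<otimes> \<one> V"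
    by (simp only: tensM_assoc[symmetric]) (simp add: interchanges)
  also have "\<dots> = \<one> (W \<boxtimes> V)"
    by (simp add: right_comodule_in.coaction_counit[OF W])
  finally show "(\<one> (W \<boxtimes> V) \<otimes> \<epsilon>) \<cdot> ?r = \<one> (W \<boxtimes> V)" .
qed

lemma regular_hmodule: "hmodule H m"
  using free_hmodule[of \<I>] by simp

text \<open>Mirror image of \<open>tensor_hcomodule\<close>. It serves to cancel what has been
  multiplied onto the first component of a coaction.\<close>

lemma tensor_hmodule:
  assumes M: "hmodule M \<beta>"
  shows "hmodule (M \<boxtimes> V) ((\<beta> \<otimes> \<one> V) \<cdot> (\<one> M \<otimes> \<sigma> V H))"
proof
  note [simp] = hmodule_ends[OF M]
  let ?k = "(\<beta> \<otimes> \<one> V) \<cdot> (\<one> M \<otimes> \<sigma> V H)"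
  show "?k \<in> hom C ((M \<boxtimes> V) \<boxtimes> H) (M \<boxtimes> V)"
    by (simp add: hom_iff)
  have "?k \<cdot> (\<one> (M \<boxtimes> V) \<otimes> m) = (\<beta> \<otimes> \<one> V) \<cdot> (\<one> M \<otimes> (\<sigma> V H \<cdot> (\<one> V \<otimes> m)))"
    by (simp only: split_idents) (simp add: interchanges)
  also have "\<dots> = (\<beta> \<otimes> \<one> V) \<cdot> (\<one> M \<otimes> ((m \<otimes> \<one> V) \<cdot> \<sigma> V (H \<boxtimes> H)))"
    by (simp add: braid_nat)
  also have "\<dots> = (\<beta> \<otimes> \<one> V) \<cdot> ((\<one> M \<otimes> m) \<otimes> \<one> V) \<cdot> (\<one> M \<otimes> \<sigma> V (H \<boxtimes> H))"
    by (simp only: split_idents) (simp add: interchanges)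
  also have "\<dots> = ((\<beta> \<cdot> (\<beta> \<otimes> \<one> H)) \<otimes> \<one> V) \<cdot> (\<one> M \<otimes> ((\<one> H \<otimes> \<sigma> V H) \<cdot> (\<sigma> V H \<otimes> \<one> H)))"
    using right_module_in.action_mult[OF M] by (simp add: interchanges hexagon_right)
  also have "\<dots> = (\<beta> \<otimes> \<one> V) \<cdot> (((\<beta> \<otimes> \<one> (H \<boxtimes> V)) \<cdot> (\<one> (M \<boxtimes> H) \<otimes> \<sigma> V H)) \<cdot> (\<one> M \<otimes> \<sigma> V H \<otimes> \<one> H))"
    by (simp add: layers del: unit_simps(3))
  also have "\<dots> = (\<beta> \<otimes> \<one> V) \<cdot> ((\<one> M \<otimes> \<sigma> V H) \<cdot> (\<beta> \<otimes> \<one> (V \<boxtimes> H))) \<cdot> (\<one> M \<otimes> \<sigma> V H \<otimes> \<one> H)"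
    by (simp add: interchange)
  also have "\<dots> = ?k \<cdot> (?k \<otimes> \<one> H)"
    by (simp only: split_idents) (simp add: interchanges tensM_assoc[symmetric] del: unit_simps(3))
  finally show "?k \<cdot> (\<one> (M \<boxtimes> V) \<otimes> m) = ?k \<cdot> (?k \<otimes> \<one> H)" .
  have "?k \<cdot> (\<one> (M \<boxtimes> V) \<otimes> \<eta>) = (\<beta> \<otimes> \<one> V) \<cdot> (\<one> M \<otimes> (\<sigma> V H \<cdot> (\<one> V \<otimes> \<eta>)))"
    by (simp only: split_idents) (simp add: interchanges)
  also have "\<dots> = (\<beta> \<otimes> \<one> V) \<cdot> (\<one> M \<otimes> \<eta> \<otimes> \<one> V)"
    using braid_nat[of "\<one> V" V \<eta> \<I> V H] by simp
  also have "\<dots> = (\<beta> \<cdot> (\<one> M \<otimes> \<eta>)) \<otimes> \<one> V"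
    by (simp only: tensM_assoc[symmetric]) (simp add: interchanges)
  also have "\<dots> = \<one> (M \<boxtimes> V)"
    by (simp add: right_module_in.action_unit[OF M])
  finally show "?k \<cdot> (\<one> (M \<boxtimes> V) \<otimes> \<eta>) = \<one> (M \<boxtimes> V)" .
qed

section \<open>The antipode preserves the unit and reverses products\<close>

lemma antipode_unit: "S \<cdot> \<eta> = \<eta>"
proof -
  have "\<eta> = \<eta> \<cdot> \<epsilon> \<cdot> \<eta>"
    by (simp add: counit_unit)
  also have "\<dots> = m \<cdot> (S \<otimes> \<one> H) \<cdot> (\<Delta> \<cdot> \<eta>)"
    using arg_cong[OF antipode(1), of "\<lambda>x. x \<cdot> \<eta>"] by simp
  also have "\<dots> = m \<cdot> ((\<one> H \<otimes> \<eta>) \<cdot> ((S \<cdot> \<eta>) \<otimes> \<one> \<I>))"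
    by (simp add: comult_unit interchange del: unit_simps(2))
  also have "\<dots> = S \<cdot> \<eta>"
    using comp_tail[OF mult_unit(2), of "S \<cdot> \<eta>"] by simp
  finally show ?thesis ..
qed

text \<open>
  Both sides are inverse to \<open>m\<close> under convolution. Cancelling the two tensor factors one after the
  other avoids the coalgebra structure on \<open>H \<otimes> H\<close>.
\<close>

lemma antipode_mult: "S \<cdot> m = m \<cdot> (S \<otimes> S) \<cdot> \<sigma> H H"
proof -
  define r where "r = (\<one> H \<otimes> \<sigma> H H) \<cdot> (\<Delta> \<otimes> \<one> H)"
  have r: "hcomodule (H \<boxtimes> H) r" and r2: "hcomodule (H \<boxtimes> H) (\<one> H \<otimes> \<Delta>)"
    unfolding r_def using tensor_hcomodule[of H \<Delta> H] free_hcomodule[of \<I>] free_hcomodule[of H] by simp_all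
  \<comment> \<open>The coaction \<open>r\<close> splits the first factor only; along it
    \<open>S(k) S(h\<^sub>1) h\<^sub>2\<close> collapses by the antipode axiom to
    \<open>\<epsilon>(h) S(k)\<close>.\<close>
  have g1: "m \<cdot> ((m \<cdot> (S \<otimes> S) \<cdot> \<sigma> H H) \<otimes> \<one> H) \<cdot> r = \<epsilon> \<otimes> S"
  proof -
    have "m \<cdot> ((m \<cdot> (S \<otimes> S) \<cdot> \<sigma> H H) \<otimes> \<one> H) \<cdot> r
        = (m \<cdot> (m \<otimes> \<one> H)) \<cdot> ((S \<otimes> S) \<otimes> \<one> H) \<cdot> ((\<sigma> H H \<otimes> \<one> H) \<cdot> (\<one> H \<otimes> \<sigma> H H)) \<cdot> (\<Delta> \<otimes> \<one> H)"
      by (simp add: r_def interchanges)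
    also have "\<dots> = (m \<cdot> (\<one> H \<otimes> m)) \<cdot> (S \<otimes> S \<otimes> \<one> H) \<cdot> (\<sigma> (H \<boxtimes> H) H \<cdot> (\<Delta> \<otimes> \<one> H))"
      by (simp only: mult_assoc tensM_assoc hexagon_left)
    also have "\<dots> = m \<cdot> (S \<otimes> (m \<cdot> (S \<otimes> \<one> H) \<cdot> \<Delta>)) \<cdot> \<sigma> H H"
      by (simp add: braid_nat interchanges)
    also have "\<dots> = m \<cdot> (\<one> H \<otimes> \<eta>) \<cdot> (S \<otimes> \<epsilon>) \<cdot> \<sigma> H H"
      by (simp add: antipode interchanges)
    also have "\<dots> = (S \<otimes> \<epsilon>) \<cdot> \<sigma> H H"
      using comp_tail[OF mult_unit(2), of "(S \<otimes> \<epsilon>) \<cdot> \<sigma> H H"] by simp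
    also have "\<dots> = \<epsilon> \<otimes> S"
      using braid_nat[of \<epsilon> H S H \<I> H] by simp
    finally show ?thesis .
  qed
  \<comment> \<open>Convolving along both factors in turn forms
    \<open>S(h\<^sub>1 k\<^sub>1) h\<^sub>2 k\<^sub>2\<close>. Here \<open>comult_mult\<close>
    recognises the coproduct of \<open>h k\<close>, so the antipode axiom applies.\<close>
  have "m \<cdot> ((m \<cdot> ((S \<cdot> m) \<otimes> \<one> H) \<cdot> r) \<otimes> \<one> H) \<cdot> (\<one> H \<otimes> \<Delta>)
      = (m \<cdot> (m \<otimes> \<one> H)) \<cdot> (((S \<cdot> m) \<otimes> \<one> H) \<otimes> \<one> H) \<cdot> (\<one> H \<otimes> \<sigma> H H \<otimes> \<one> H) \<cdot> (\<Delta> \<otimes> \<one> (H \<boxtimes> H))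
      \<cdot> (\<one> H \<otimes> \<Delta>)"
    by (simp only: split_idents r_def) (simp add: interchanges tensM_assoc[symmetric] del: unit_simps(3))
  also have "\<dots> = (m \<cdot> (\<one> H \<otimes> m)) \<cdot> ((S \<cdot> m) \<otimes> \<one> (H \<boxtimes> H)) \<cdot> (\<one> H \<otimes> \<sigma> H H \<otimes> \<one> H) \<cdot> (\<Delta> \<otimes> \<Delta>)"
    by (simp only: mult_assoc tensM_assoc tens_ident) (simp add: interchanges)
  also have "\<dots> = m \<cdot> (S \<otimes> \<one> H) \<cdot> ((m \<otimes> m) \<cdot> (\<one> H \<otimes> \<sigma> H H \<otimes> \<one> H) \<cdot> (\<Delta> \<otimes> \<Delta>))"
    by (simp add: interchanges)
  also have "\<dots> = (m \<cdot> (S \<otimes> \<one> H) \<cdot> \<Delta>) \<cdot> m"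
    unfolding comult_mult[symmetric] by simp
  also have "\<dots> = \<epsilon> \<otimes> (\<eta> \<cdot> \<epsilon>)"
    using interchange[of \<epsilon> "\<one> \<I>" \<epsilon> \<eta>] by (simp add: antipode counit_mult)
  also have "\<dots> = m \<cdot> ((\<epsilon> \<otimes> S) \<otimes> \<one> H) \<cdot> (\<one> H \<otimes> \<Delta>)"
    using interchange[of "\<epsilon>" "\<one> \<I>" "(S \<otimes> \<one> H) \<cdot> \<Delta>" m] 
    by (simp add: antipode[symmetric] tensM_assoc interchange)
  finally have "m \<cdot> ((S \<cdot> m) \<otimes> \<one> H) \<cdot> r = \<epsilon> \<otimes> S"
    by (rule conv_cancel[OF regular_hmodule r2, rotated -1]) (simp_all add: hcomodule_ends[OF r])
  then show ?thesis
    unfolding g1[symmetric] by (rule conv_cancel[OF regular_hmodule r, rotated -1]) simp_all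
qed

text \<open>Multiplying the second tensor factor by a further component of \<open>h\<close> turns
  both sides into \<open>\<Delta> \<otimes> \<epsilon>\<close>: on the left
  \<open>S(h\<^sub>1) h\<^sub>2\<close> collapses, on the right the factors assemble to the
  coproduct of \<open>x S(h\<^sub>1) h\<^sub>2\<close>. The multiplication is undone by
  \<open>conv_cancel\<close>.\<close>

lemma comult_antipode_cancel:
  "(\<one> H \<otimes> (m \<cdot> (\<one> H \<otimes> S))) \<cdot> (\<Delta> \<otimes> \<one> H)
     = (m \<otimes> \<one> H) \<cdot> (\<one> H \<otimes> \<sigma> H H) \<cdot> ((\<Delta> \<cdot> m \<cdot> (\<one> H \<otimes> S)) \<otimes> \<one> H) \<cdot> (\<one> H \<otimes> \<Delta>)" (is "?L = ?R")
proof (rule conv_cancel[OF free_hmodule free_hcomodule])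
  let ?q = "m \<cdot> (\<one> H \<otimes> S)"
  have "(\<one> H \<otimes> m) \<cdot> (?L \<otimes> \<one> H) \<cdot> (\<one> H \<otimes> \<Delta>)
      = (\<one> H \<otimes> (m \<cdot> (m \<otimes> \<one> H))) \<cdot> (\<one> H \<otimes> (\<one> H \<otimes> S) \<otimes> \<one> H) \<cdot> (\<Delta> \<otimes> \<one> (H \<boxtimes> H)) \<cdot> (\<one> H \<otimes> \<Delta>)"
    by (simp add: layers del: unit_simps(3))
  also have "\<dots> = (\<one> H \<otimes> (m \<cdot> (\<one> H \<otimes> m))) \<cdot> (\<one> H \<otimes> \<one> H \<otimes> (S \<otimes> \<one> H)) \<cdot> (\<one> (H \<boxtimes> H) \<otimes> \<Delta>) \<cdot> (\<Delta> \<otimes> \<one> H)"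
    by (simp only: mult_assoc tensM_assoc) (simp add: interchanges)
  also have "\<dots> = (\<one> H \<otimes> m) \<cdot> (\<one> H \<otimes> (\<one> H \<otimes> (m \<cdot> (S \<otimes> \<one> H) \<cdot> \<Delta>))) \<cdot> (\<Delta> \<otimes> \<one> H)"
    by (simp only: split_idents) (simp add: interchanges)
  also have "\<dots> = (\<one> H \<otimes> (m \<cdot> (\<one> H \<otimes> \<eta>))) \<cdot> (\<one> (H \<boxtimes> H) \<otimes> \<epsilon>) \<cdot> (\<Delta> \<otimes> \<one> H)"
    by (simp only: split_idents antipode) (simp add: interchanges)
  also have "\<dots> = \<Delta> \<otimes> \<epsilon>"
    by (simp add: mult_unit interchanges)
  finally have L: "(\<one> H \<otimes> m) \<cdot> (?L \<otimes> \<one> H) \<cdot> (\<one> H \<otimes> \<Delta>) = \<Delta> \<otimes> \<epsilon>" .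
  have "(\<one> H \<otimes> m) \<cdot> (?R \<otimes> \<one> H) \<cdot> (\<one> H \<otimes> \<Delta>)
     = (\<one> H \<otimes> m) \<cdot> (m \<otimes> \<one> (H \<boxtimes> H)) \<cdot> (\<one> H \<otimes> \<sigma> H H \<otimes> \<one> H) \<cdot> ((\<Delta> \<cdot> ?q) \<otimes> \<one> (H \<boxtimes> H))
     \<cdot> (((\<one> H \<otimes> \<Delta>) \<otimes> \<one> H) \<cdot> (\<one> H \<otimes> \<Delta>))"
    by (simp only: split_idents) (simp add: interchanges tensM_assoc[symmetric] del: unit_simps(3))
  also have "((\<one> H \<otimes> \<Delta>) \<otimes> \<one> H) \<cdot> (\<one> H \<otimes> \<Delta>) = (\<one> (H \<boxtimes> H) \<otimes> \<Delta>) \<cdot> (\<one> H \<otimes> \<Delta>)"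
    using right_comodule_in.coaction_comult[OF free_hcomodule[of H]] by simp
  also have "(\<one> H \<otimes> m) \<cdot> (m \<otimes> \<one> (H \<boxtimes> H)) \<cdot> (\<one> H \<otimes> \<sigma> H H \<otimes> \<one> H) \<cdot> ((\<Delta> \<cdot> ?q) \<otimes> \<one> (H \<boxtimes> H))
      \<cdot> ((\<one> (H \<boxtimes> H) \<otimes> \<Delta>) \<cdot> (\<one> H \<otimes> \<Delta>))
     = ((m \<otimes> m) \<cdot> (\<one> H \<otimes> \<sigma> H H \<otimes> \<one> H) \<cdot> (\<Delta> \<otimes> \<Delta>)) \<cdot> (?q \<otimes> \<one> H) \<cdot> (\<one> H \<otimes> \<Delta>)"
    by (simp add: interchanges)
  also have "\<dots> = \<Delta> \<cdot> ((m \<cdot> (m \<otimes> \<one> H)) \<cdot> ((\<one> H \<otimes> S) \<otimes> \<one> H) \<cdot> (\<one> H \<otimes> \<Delta>))"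
    unfolding comult_mult[symmetric] by (simp add: interchanges)
  also have "\<dots> = \<Delta> \<cdot> (m \<cdot> (\<one> H \<otimes> (m \<cdot> (S \<otimes> \<one> H) \<cdot> \<Delta>)))"
    by (simp only: mult_assoc tensM_assoc) (simp add: interchanges)
  also have "\<dots> = \<Delta> \<cdot> (m \<cdot> (\<one> H \<otimes> \<eta>)) \<cdot> (\<one> H \<otimes> \<epsilon>)"
    by (simp add: antipode interchanges)
  also have "\<dots> = \<Delta> \<otimes> \<epsilon>"
    using interchange[of "\<one> H" \<Delta> \<epsilon> "\<one> \<I>"] by (simp add: mult_unit)
  finally show "(\<one> H \<otimes> m) \<cdot> (?L \<otimes> \<one> H) \<cdot> (\<one> H \<otimes> \<Delta>) = (\<one> H \<otimes> m) \<cdot> (?R \<otimes> \<one> H) \<cdot> (\<one> H \<otimes> \<Delta>)"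
    using L by simp
qed simp_all

lemma twist_braid: "(m \<cdot> \<sigma> H H \<cdot> (S \<otimes> \<one> H)) \<cdot> \<sigma> H H = m \<cdot> (\<one> H \<otimes> S)"
proof -
  have "(m \<cdot> \<sigma> H H \<cdot> (S \<otimes> \<one> H)) \<cdot> \<sigma> H H = m \<cdot> \<sigma> H H \<cdot> (\<sigma> H H \<cdot> (\<one> H \<otimes> S))"
    by (simp add: braid_nat[of "\<one> H" H S H])
  also have "\<dots> = m \<cdot> (\<one> H \<otimes> S)"
    using comp_tail[OF braid_HH] by simp
  finally show ?thesis .
qed

text \<open>This is \<open>comult_antipode_cancel\<close> with \<open>h\<close> placed before
  \<open>x\<close>, the order in which the pairing produces it. Precomposing with
  \<open>\<sigma> H H\<close> restores the other order and can be cancelled, because this braiding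
  squares to the identity.\<close>

lemma twist_comult:
  defines "B \<equiv> m \<cdot> \<sigma> H H \<cdot> (S \<otimes> \<one> H)"
  shows "(\<one> H \<otimes> B) \<cdot> (\<sigma> H H \<otimes> \<one> H) \<cdot> (\<one> H \<otimes> \<Delta>)
    = ((m \<cdot> \<sigma> H H) \<otimes> \<one> H) \<cdot> (\<one> H \<otimes> (\<Delta> \<cdot> B)) \<cdot> ((\<sigma> H H \<cdot> \<Delta>) \<otimes> \<one> H)" (is "?X = ?Y")
proof -
  have [simp]: "Source C B = H \<boxtimes> H" "Target C B = H"
    by (simp_all add: B_def)
  have B: "B \<cdot> \<sigma> H H = m \<cdot> (\<one> H \<otimes> S)"
    unfolding B_def by (rule twist_braid)
  define q where "q = m \<cdot> (\<one> H \<otimes> S)"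
  have [simp]: "Source C q = H \<boxtimes> H" "Target C q = H"
    by (simp_all add: q_def)
  have BC: "(\<one> H \<otimes> B) \<cdot> (\<one> H \<otimes> \<sigma> H H) = \<one> H \<otimes> q"
    by (simp add: interchanges B q_def)
  have "?X \<cdot> \<sigma> H H = (\<one> H \<otimes> B) \<cdot> (\<sigma> H H \<otimes> \<one> H) \<cdot> (\<sigma> (H \<boxtimes> H) H \<cdot> (\<Delta> \<otimes> \<one> H))"
    by (simp add: braid_nat)
  also have "\<dots> = (\<one> H \<otimes> B) \<cdot> (((\<sigma> H H \<cdot> \<sigma> H H) \<otimes> \<one> H) \<cdot> (\<one> H \<otimes> \<sigma> H H) \<cdot> (\<Delta> \<otimes> \<one> H))"
    by (simp add: hexagon_left whisker)
  also have "\<dots> = (\<one> H \<otimes> q) \<cdot> (\<Delta> \<otimes> \<one> H)"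
    using comp_tail[OF BC] by (simp add: braid_HH)
  finally have X: "?X \<cdot> \<sigma> H H = (\<one> H \<otimes> q) \<cdot> (\<Delta> \<otimes> \<one> H)" .
  have "?Y \<cdot> \<sigma> H H = ((m \<cdot> \<sigma> H H) \<otimes> \<one> H) \<cdot> (\<one> H \<otimes> (\<Delta> \<cdot> B)) \<cdot> (\<sigma> H (H \<boxtimes> H) \<cdot> (\<one> H \<otimes> (\<sigma> H H \<cdot> \<Delta>)))"
    by (simp add: braid_nat)
  also have "\<dots> = ((m \<cdot> \<sigma> H H) \<otimes> \<one> H) \<cdot> (\<one> H \<otimes> \<Delta>) \<cdot> (((\<one> H \<otimes> B) \<cdot> (\<one> H \<otimes> \<sigma> H H)) \<cdot> (\<sigma> H H \<otimes> \<one> H)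
      \<cdot> (\<one> H \<otimes> \<sigma> H H) \<cdot> (\<one> H \<otimes> \<Delta>))"
    by (simp add: hexagon_right whisker)
  also have "\<dots> = ((m \<cdot> \<sigma> H H) \<otimes> \<one> H) \<cdot> (\<one> H \<otimes> \<Delta>) \<cdot> ((\<one> H \<otimes> q) \<cdot> \<sigma> (H \<boxtimes> H) H \<cdot> (\<one> H \<otimes> \<Delta>))"
    unfolding BC by (simp add: hexagon_left)
  also have "\<dots> = ((m \<cdot> \<sigma> H H) \<otimes> \<one> H) \<cdot> (\<sigma> (H \<boxtimes> H) H \<cdot> (\<Delta> \<otimes> \<one> H)) \<cdot> (q \<otimes> \<one> H) \<cdot> (\<one> H \<otimes> \<Delta>)"
    using comp_eq_tail[OF braid_nat[of q "H \<boxtimes> H" "\<one> H" H H H], of "\<one> H \<otimes> \<Delta>"]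
    by (simp add: braid_nat)
  also have "\<dots> = (m \<otimes> \<one> H) \<cdot> (((\<sigma> H H \<cdot> \<sigma> H H) \<otimes> \<one> H) \<cdot> (\<one> H \<otimes> \<sigma> H H)) \<cdot> ((\<Delta> \<cdot> q) \<otimes> \<one> H)
      \<cdot> (\<one> H \<otimes> \<Delta>)"
    by (simp add: hexagon_left whisker)
  also have "\<dots> = (\<one> H \<otimes> q) \<cdot> (\<Delta> \<otimes> \<one> H)"
    using comult_antipode_cancel by (simp add: braid_HH q_def)
  finally have "(?X \<cdot> \<sigma> H H) \<cdot> \<sigma> H H = (?Y \<cdot> \<sigma> H H) \<cdot> \<sigma> H H"
    using X by simp
  then have "?X \<cdot> (\<sigma> H H \<cdot> \<sigma> H H) = ?Y \<cdot> (\<sigma> H H \<cdot> \<sigma> H H)"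
    by simp
  then show ?thesis
    unfolding braid_HH by simp
qed

text \<open>Since \<open>S\<close> reverses products, \<open>x S(h)\<close> defines a left action of
  \<open>H\<close> on itself. Its transpose will be the right action on the dual.\<close>

lemma twist_mult:
  defines "B \<equiv> m \<cdot> \<sigma> H H \<cdot> (S \<otimes> \<one> H)"
  shows "B \<cdot> (m \<otimes> \<one> H) = B \<cdot> (\<one> H \<otimes> B)" and "B \<cdot> (\<eta> \<otimes> \<one> H) = \<one> H"
proof -
  have B: "B = m \<cdot> (\<one> H \<otimes> S) \<cdot> \<sigma> H H"
    by (simp add: B_def braid_nat)
  have "B \<cdot> (m \<otimes> \<one> H) = m \<cdot> (\<one> H \<otimes> (S \<cdot> m)) \<cdot> \<sigma> (H \<boxtimes> H) H"
    by (simp add: B braid_nat whisker)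
  also have "\<dots> = (m \<cdot> (\<one> H \<otimes> m)) \<cdot> (\<one> H \<otimes> S \<otimes> S) \<cdot> (\<one> H \<otimes> \<sigma> H H) \<cdot> \<sigma> (H \<boxtimes> H) H"
    unfolding antipode_mult by (simp add: whisker)
  also have "\<dots> = (m \<cdot> (m \<otimes> \<one> H)) \<cdot> ((\<one> H \<otimes> S) \<otimes> S) \<cdot> \<sigma> H (H \<boxtimes> H) \<cdot> (\<one> H \<otimes> \<sigma> H H)"
    by (simp add: hexagon_left hexagon_right mult_assoc tensM_assoc)
  also have "\<dots> = m \<cdot> (\<one> H \<otimes> S) \<cdot> (((m \<cdot> (\<one> H \<otimes> S)) \<otimes> \<one> H) \<cdot> \<sigma> H (H \<boxtimes> H)) \<cdot> (\<one> H \<otimes> \<sigma> H H)"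
    by (simp add: interchanges)
  also have "\<dots> = m \<cdot> (\<one> H \<otimes> S) \<cdot> (\<sigma> H H \<cdot> (\<one> H \<otimes> (m \<cdot> (\<one> H \<otimes> S)))) \<cdot> (\<one> H \<otimes> \<sigma> H H)"
    by (subst braid_nat[of "\<one> H" H "m \<cdot> (\<one> H \<otimes> S)" "H \<boxtimes> H"]) simp_all
  also have "\<dots> = B \<cdot> (\<one> H \<otimes> B)"
    by (simp add: B interchanges)
  finally show "B \<cdot> (m \<otimes> \<one> H) = B \<cdot> (\<one> H \<otimes> B)" .
  have "B \<cdot> (\<eta> \<otimes> \<one> H) = m \<cdot> (\<one> H \<otimes> (S \<cdot> \<eta>))"
    using braid_nat[of \<eta> \<I> "\<one> H" H H H] by (simp add: B whisker)
  then show "B \<cdot> (\<eta> \<otimes> \<one> H) = \<one> H"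
    by (simp add: antipode_unit mult_unit)
qed

section \<open>The fundamental theorem of Hopf modules\<close>

abbreviation hopf_mod where "hopf_mod M \<beta> \<rho> \<equiv> hopf_module C H m \<eta> \<Delta> \<epsilon> M \<beta> \<rho>"

lemma free_hopf_module: "hopf_mod (V \<boxtimes> H) (\<one> V \<otimes> m) (\<one> V \<otimes> \<Delta>)"
proof (intro hopf_module.intro free_hmodule free_hcomodule hopf_module_axioms.intro)
  have "(\<one> V \<otimes> \<Delta>) \<cdot> (\<one> V \<otimes> m) = \<one> V \<otimes> ((m \<otimes> m) \<cdot> (\<one> H \<otimes> \<sigma> H H \<otimes> \<one> H) \<cdot> (\<Delta> \<otimes> \<Delta>))"
    unfolding comult_mult[symmetric] by (simp add: interchanges)
  also have "\<dots> = ((\<one> V \<otimes> m) \<otimes> m) \<cdot> (\<one> (V \<boxtimes> H) \<otimes> \<sigma> H H \<otimes> \<one> H) \<cdot> ((\<one> V \<otimes> \<Delta>) \<otimes> \<Delta>)"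
    by (simp only: split_idents) (simp add: interchanges)
  finally show "(\<one> V \<otimes> \<Delta>) \<cdot> (\<one> V \<otimes> m)
      = ((\<one> V \<otimes> m) \<otimes> m) \<cdot> (\<one> (V \<boxtimes> H) \<otimes> \<sigma> H H \<otimes> \<one> H) \<cdot> ((\<one> V \<otimes> \<Delta>) \<otimes> \<Delta>)" .
qed

text \<open>The first equation is \<open>x\<^sub>0 S(x\<^sub>1) x\<^sub>2 = x\<close>. For the
  second, further components of \<open>x\<close> are multiplied onto both tensor factors and
  cancelled one after the other.\<close>

lemma coinvariant_projection:
  assumes M: "hopf_mod M \<beta> \<rho>"
  defines "P \<equiv> \<beta> \<cdot> (\<one> M \<otimes> S) \<cdot> \<rho>"
  shows "\<beta> \<cdot> (P \<otimes> \<one> H) \<cdot> \<rho> = \<one> M" and "\<rho> \<cdot> P = P \<otimes> \<eta>"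
proof -
  interpret hopf_module C H m \<eta> \<Delta> \<epsilon> M \<beta> \<rho> by fact
  have A: "hmodule M \<beta>" and W: "hcomodule M \<rho>" by unfold_locales
  note [simp] = hmodule_ends[OF A] hcomodule_ends[OF W]
  have [simp]: "Source C P = M" "Target C P = M"
    by (simp_all add: P_def)
  show P: "\<beta> \<cdot> (P \<otimes> \<one> H) \<cdot> \<rho> = \<one> M"
    unfolding P_def using conv_assoc[OF A W, of "\<one> M" S "\<one> H"] conv_unit[OF A W, of "\<one> M"]
    by (simp add: antipode)
  \<comment> \<open>\<open>?\<kappa>\<close> lets \<open>H\<close> act on the first component of
    \<open>M \<boxtimes> H\<close>. After one more multiplication on the second component, the left
    side becomes \<open>\<rho>(P(x\<^sub>0) x\<^sub>1) = \<rho>(x)\<close>, which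
    \<open>x \<otimes> 1\<close> yields as well.\<close>
  let ?\<kappa> = "(\<beta> \<otimes> \<one> H) \<cdot> (\<one> M \<otimes> \<sigma> H H)"
  have "(\<one> M \<otimes> m) \<cdot> ((?\<kappa> \<cdot> ((\<rho> \<cdot> P) \<otimes> \<one> H) \<cdot> \<rho>) \<otimes> \<one> H) \<cdot> \<rho>
      = (\<one> M \<otimes> m) \<cdot> (\<beta> \<otimes> \<one> (H \<boxtimes> H)) \<cdot> (\<one> M \<otimes> \<sigma> H H \<otimes> \<one> H) \<cdot> (\<rho> \<otimes> \<one> (H \<boxtimes> H)) \<cdot> (P \<otimes> \<one> (H \<boxtimes> H))
      \<cdot> ((\<rho> \<otimes> \<one> H) \<cdot> \<rho>)"
    by (simp add: layers del: unit_simps(3))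
  also have "\<dots> = ((\<beta> \<otimes> m) \<cdot> (\<one> M \<otimes> \<sigma> H H \<otimes> \<one> H) \<cdot> (\<rho> \<otimes> \<Delta>)) \<cdot> ((P \<otimes> \<one> H) \<cdot> \<rho>)"
    unfolding coaction_comult[symmetric] by (simp add: interchanges)
  also have "\<dots> = \<rho>"
    unfolding coaction_action[symmetric] using P by simp
  also have "\<rho> = (\<one> M \<otimes> (m \<cdot> (\<eta> \<otimes> \<one> H))) \<cdot> \<rho>"
    by (simp add: mult_unit)
  also have "\<dots> = (\<one> M \<otimes> m) \<cdot> ((\<one> M \<otimes> \<eta>) \<otimes> \<one> H) \<cdot> \<rho>"
    by (simp add: layers del: unit_simps(3))
  finally have "?\<kappa> \<cdot> ((\<rho> \<cdot> P) \<otimes> \<one> H) \<cdot> \<rho> = \<one> M \<otimes> \<eta>"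
    by (rule conv_cancel[OF free_hmodule W, rotated -1]) simp_all
  \<comment> \<open>Writing \<open>x\<close> as \<open>P(x\<^sub>0) x\<^sub>1\<close> exhibits
    \<open>x \<otimes> 1\<close> as a convolution of \<open>P \<otimes> \<eta>\<close> with respect
    to \<open>?\<kappa>\<close>, ready to be cancelled.\<close>
  also have "\<one> M \<otimes> \<eta> = (\<beta> \<otimes> \<one> H) \<cdot> (P \<otimes> \<one> H \<otimes> \<eta>) \<cdot> \<rho>"
    unfolding P[symmetric] using interchange[of "(P \<otimes> \<one> H) \<cdot> \<rho>" \<beta> \<eta> "\<one> H"] interchange[of \<rho> "P \<otimes> \<one> H" "\<one> \<I>" \<eta>]
    by (simp add: tensM_assoc)
  also have "\<dots> = (\<beta> \<otimes> \<one> H) \<cdot> (P \<otimes> (\<sigma> H H \<cdot> (\<eta> \<otimes> \<one> H))) \<cdot> \<rho>"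
    using braid_nat[of \<eta> \<I> "\<one> H" H H H] by simp
  also have "\<dots> = ?\<kappa> \<cdot> ((P \<otimes> \<eta>) \<otimes> \<one> H) \<cdot> \<rho>"
    by (simp add: tensM_assoc interchanges)
  finally show "\<rho> \<cdot> P = P \<otimes> \<eta>"
    by (rule conv_cancel[OF tensor_hmodule[OF A] W, rotated -1]) simp_all
qed

text \<open>On a coinvariant the formula \<open>x\<^sub>0 S(x\<^sub>1)\<close> becomes
  \<open>z S(1)\<close>, and \<open>S(1) = 1\<close>. With \<open>coinvariant_projection\<close>
  this makes \<open>P\<close> an idempotent whose fixed points are the coinvariants.\<close>

lemma projection_of_coinvariant:
  assumes A: "hmodule M \<beta>" and [simp]: "Target C z = M" and z: "\<rho> \<cdot> z = z \<otimes> \<eta>"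
  shows "\<beta> \<cdot> (\<one> M \<otimes> S) \<cdot> \<rho> \<cdot> z = z"
proof -
  note [simp] = hmodule_ends[OF A]
  have "\<beta> \<cdot> (\<one> M \<otimes> S) \<cdot> \<rho> \<cdot> z = (\<beta> \<cdot> (\<one> M \<otimes> \<eta>)) \<cdot> (z \<otimes> \<one> \<I>)"
    by (simp add: z interchanges antipode_unit del: unit_simps(2))
  then show ?thesis
    by (simp add: right_module_in.action_unit[OF A])
qed

text \<open>The map \<open>x \<mapsto> p(x\<^sub>0) \<otimes> x\<^sub>1\<close> has the inverse
  \<open>a \<otimes> h \<mapsto> i(a) h\<close>. Starting from an arbitrary splitting of the
  projection makes the result apply to every object \<open>J\<close> that represents the
  coinvariants.\<close>

theorem fundamental_theorem:
  assumes M: "hopf_mod M \<beta> \<rho>"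
    and i: "Source C i = J" "Target C i = M" and p: "Source C p = M" "Target C p = J"
    and ip: "i \<cdot> p = \<beta> \<cdot> (\<one> M \<otimes> S) \<cdot> \<rho>" and pi: "p \<cdot> i = \<one> J"
  shows "hopf_module_iso C H m \<eta> \<Delta> \<epsilon> M \<beta> \<rho> (J \<boxtimes> H) (\<one> J \<otimes> m) (\<one> J \<otimes> \<Delta>) ((p \<otimes> \<one> H) \<cdot> \<rho>)"
proof -
  interpret hopf_module C H m \<eta> \<Delta> \<epsilon> M \<beta> \<rho> by fact
  have A: "hmodule M \<beta>" and W: "hcomodule M \<rho>" by unfold_locales
  note [simp] = hmodule_ends[OF A] hcomodule_ends[OF W] i p
  let ?\<phi> = "(p \<otimes> \<one> H) \<cdot> \<rho>" and ?\<psi> = "\<beta> \<cdot> (i \<otimes> \<one> H)"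
  \<comment> \<open>As \<open>i\<close> equals \<open>(i \<cdot> p) \<cdot> i\<close>, it inherits
    coinvariance from the projection.\<close>
  have "\<rho> \<cdot> i = (\<rho> \<cdot> (i \<cdot> p)) \<cdot> i"
    by (simp add: pi)
  also have "\<dots> = ((i \<cdot> p) \<otimes> \<eta>) \<cdot> (i \<otimes> \<one> \<I>)"
    unfolding ip coinvariant_projection(2)[OF M] by simp
  also have "\<dots> = i \<otimes> \<eta>"
    by (simp add: interchanges pi del: unit_simps(2))
  finally have \<rho>i: "\<rho> \<cdot> i = i \<otimes> \<eta>" .
  have \<psi>\<phi>: "?\<psi> \<cdot> ?\<phi> = \<one> M"
    using coinvariant_projection(1)[OF M] by (simp add: interchanges ip[symmetric])
  have \<rho>\<psi>: "\<rho> \<cdot> ?\<psi> = (?\<psi> \<otimes> \<one> H) \<cdot> (\<one> J \<otimes> \<Delta>)"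
  proof -
    have "\<rho> \<cdot> ?\<psi> = ((\<beta> \<otimes> m) \<cdot> (\<one> M \<otimes> \<sigma> H H \<otimes> \<one> H) \<cdot> (\<rho> \<otimes> \<Delta>)) \<cdot> (i \<otimes> \<one> H)"
      unfolding coaction_action[symmetric] by simp
    also have "\<dots> = (\<beta> \<otimes> m) \<cdot> (i \<otimes> (\<sigma> H H \<cdot> (\<eta> \<otimes> \<one> H)) \<otimes> \<one> H) \<cdot> (\<one> J \<otimes> \<Delta>)"
      using interchange[of "\<one> \<I>" \<eta> \<Delta> "\<one> H \<otimes> \<one> H"]
      by (simp add: interchanges \<rho>i tensM_assoc whisker)
    also have "\<dots> = (\<beta> \<otimes> m) \<cdot> ((i \<otimes> \<one> H) \<otimes> (\<eta> \<otimes> \<one> H)) \<cdot> (\<one> J \<otimes> \<Delta>)"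
      using braid_nat[of \<eta> \<I> "\<one> H" H H H] by (simp add: tensM_assoc)
    also have "\<dots> = (?\<psi> \<otimes> \<one> H) \<cdot> (\<one> J \<otimes> \<Delta>)"
      by (simp add: interchange_tail mult_unit)
    finally show ?thesis .
  qed
  \<comment> \<open>The projection sends \<open>i(a) h\<close> to
    \<open>i(a) h\<^sub>1 S(h\<^sub>2) = \<epsilon>(h) i(a)\<close>, because \<open>i(a)\<close> is
    coinvariant; the retraction \<open>p\<close> then cancels \<open>i\<close>.\<close>
  have "(i \<cdot> p) \<cdot> ?\<psi> = \<beta> \<cdot> (\<one> M \<otimes> S) \<cdot> ((?\<psi> \<otimes> \<one> H) \<cdot> (\<one> J \<otimes> \<Delta>))"
    unfolding ip \<rho>\<psi>[symmetric] by simp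
  also have "\<dots> = (\<beta> \<cdot> (\<beta> \<otimes> \<one> H)) \<cdot> ((i \<otimes> \<one> H) \<otimes> S) \<cdot> (\<one> J \<otimes> \<Delta>)"
    by (simp add: interchanges)
  also have "\<dots> = \<beta> \<cdot> (i \<otimes> (m \<cdot> (\<one> H \<otimes> S) \<cdot> \<Delta>))"
    unfolding action_mult[symmetric] tensM_assoc by (simp add: interchanges)
  also have "\<dots> = (\<beta> \<cdot> (\<one> M \<otimes> \<eta>)) \<cdot> (i \<otimes> \<epsilon>)"
    by (simp add: antipode interchanges)
  also have "\<dots> = i \<otimes> \<epsilon>"
    by (simp add: action_unit)
  finally have "i \<cdot> (p \<cdot> ?\<psi>) = i \<otimes> \<epsilon>" by simp
  then have "p \<cdot> (i \<cdot> (p \<cdot> ?\<psi>)) = p \<cdot> (i \<otimes> \<epsilon>)" by simp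
  moreover have "p \<cdot> (i \<otimes> \<epsilon>) = \<one> J \<otimes> \<epsilon>"
    using interchange[of i p \<epsilon> "\<one> \<I>"] by (simp add: pi)
  ultimately have p\<psi>: "p \<cdot> ?\<psi> = \<one> J \<otimes> \<epsilon>"
    using comp_tail[OF pi, of "p \<cdot> ?\<psi>"] by simp
  have "?\<phi> \<cdot> ?\<psi> = (p \<otimes> \<one> H) \<cdot> ((?\<psi> \<otimes> \<one> H) \<cdot> (\<one> J \<otimes> \<Delta>))"
    unfolding \<rho>\<psi>[symmetric] by simp
  also have "\<dots> = ((p \<cdot> ?\<psi>) \<otimes> \<one> H) \<cdot> (\<one> J \<otimes> \<Delta>)"
    by (simp add: interchanges)
  also have "\<dots> = \<one> (J \<boxtimes> H)"
    unfolding p\<psi> tensM_assoc by (simp add: interchanges comult_counit)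
  finally have \<phi>\<psi>: "?\<phi> \<cdot> ?\<psi> = \<one> (J \<boxtimes> H)" .
  interpret M': hopf_module C H m \<eta> \<Delta> \<epsilon> "J \<boxtimes> H" "\<one> J \<otimes> m" "\<one> J \<otimes> \<Delta>"
    by (rule free_hopf_module)
  show ?thesis
  proof unfold_locales
    show "?\<phi> \<in> hom C M (J \<boxtimes> H)"
      by (simp add: hom_iff)
    have "inverse_of C ?\<phi> ?\<psi>"
      unfolding inverse_of_def using \<psi>\<phi> \<phi>\<psi> by (simp add: hom_iff)
    then show "iso_mor C ?\<phi>"
      unfolding iso_mor_def by blast
    \<comment> \<open>Linearity of \<open>?\<psi>\<close> is associativity of the action; it passes
      to the two-sided inverse \<open>?\<phi>\<close>.\<close>
    have "?\<psi> \<cdot> (\<one> J \<otimes> m) = (\<beta> \<cdot> (\<one> M \<otimes> m)) \<cdot> (i \<otimes> \<one> (H \<boxtimes> H))"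
      by (simp add: interchanges)
    also have "\<dots> = (\<beta> \<cdot> (\<beta> \<otimes> \<one> H)) \<cdot> ((i \<otimes> \<one> H) \<otimes> \<one> H)"
      by (simp add: action_mult tensM_assoc)
    also have "\<dots> = \<beta> \<cdot> (?\<psi> \<otimes> \<one> H)"
      by (simp add: interchanges)
    finally have lin: "?\<psi> \<cdot> (\<one> J \<otimes> m) = \<beta> \<cdot> (?\<psi> \<otimes> \<one> H)" .
    have "?\<phi> \<cdot> \<beta> = ?\<phi> \<cdot> (\<beta> \<cdot> ((?\<psi> \<cdot> ?\<phi>) \<otimes> \<one> H))"
      unfolding \<psi>\<phi> by simp
    also have "\<dots> = ?\<phi> \<cdot> ((\<beta> \<cdot> (?\<psi> \<otimes> \<one> H)) \<cdot> (?\<phi> \<otimes> \<one> H))"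
      by (simp add: whisker)
    also have "\<dots> = (?\<phi> \<cdot> ?\<psi>) \<cdot> ((\<one> J \<otimes> m) \<cdot> (?\<phi> \<otimes> \<one> H))"
      unfolding lin[symmetric] by simp
    also have "\<dots> = (\<one> J \<otimes> m) \<cdot> (?\<phi> \<otimes> \<one> H)"
      unfolding \<phi>\<psi> by simp
    finally show "?\<phi> \<cdot> \<beta> = (\<one> J \<otimes> m) \<cdot> (?\<phi> \<otimes> \<one> H)" .
    have "(\<one> J \<otimes> \<Delta>) \<cdot> ?\<phi> = (p \<otimes> \<one> (H \<boxtimes> H)) \<cdot> ((\<one> M \<otimes> \<Delta>) \<cdot> \<rho>)"
      by (simp add: interchanges)
    also have "\<dots> = (p \<otimes> \<one> (H \<boxtimes> H)) \<cdot> ((\<rho> \<otimes> \<one> H) \<cdot> \<rho>)"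
      by (simp add: coaction_comult)
    also have "\<dots> = (?\<phi> \<otimes> \<one> H) \<cdot> \<rho>"
      by (simp add: layers del: unit_simps(3))
    finally show "(\<one> J \<otimes> \<Delta>) \<cdot> ?\<phi> = (?\<phi> \<otimes> \<one> H) \<cdot> \<rho>" .
  qed
qed

end

section \<open>The faithful quasi-dual\<close>

locale symmetric_hopf_dual =
  symmetric_hopf_algebra C H m \<eta> \<Delta> \<epsilon> S + N: faithful_quasi_dual C H \<Delta> \<epsilon> N mN \<eta>N ev
  for C :: "('o, 'm) tensor_cat" (structure) and H :: 'o and m \<eta> \<Delta> \<epsilon> S :: 'm
    and N :: 'o and mN \<eta>N ev :: 'm
begin

lemmas dual_ends [simp] = homD[OF N.mult_hom] homD[OF N.unit_hom] homD[OF N.ev_hom]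

text \<open>In elements, \<open>T V (g \<otimes> v \<otimes> h) = \<langle>g, h\<rangle> v\<close>; a coaction \<open>\<rho>\<close> is rational for \<open>\<alpha>\<close> if \<open>T M \<cdot> (\<one> N \<otimes> \<rho>) = \<alpha>\<close>.\<close>

definition T :: "'o \<Rightarrow> 'm" where
  "T V = (\<one> V \<otimes> ev) \<cdot> (\<sigma> N V \<otimes> \<one> H)"

lemma T_ends [simp]: "Source C (T V) = N \<boxtimes> V \<boxtimes> H" "Target C (T V) = V"
  by (simp_all add: T_def)

lemma T_natural:
  assumes [simp]: "Source C f = V" "Target C f = W"
  shows "T W \<cdot> (\<one> N \<otimes> f \<otimes> \<one> H) = f \<cdot> T V"
proof -
  have "T W \<cdot> (\<one> N \<otimes> f \<otimes> \<one> H) = (\<one> W \<otimes> ev) \<cdot> ((\<sigma> N W \<cdot> (\<one> N \<otimes> f)) \<otimes> \<one> H)"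
    by (simp add: T_def layers)
  also have "\<dots> = (\<one> W \<otimes> ev) \<cdot> ((f \<otimes> \<one> (N \<boxtimes> H)) \<cdot> (\<sigma> N V \<otimes> \<one> H))"
    by (simp add: braid_nat layers del: unit_simps(3))
  also have "\<dots> = (f \<otimes> \<one> \<I>) \<cdot> T V"
    by (simp add: T_def interchange_tail del: unit_simps(2))
  finally show ?thesis by simp
qed

text \<open>By the hexagon the two braidings form \<open>\<sigma> (N \<boxtimes> H) V\<close>, and
  \<open>ev\<close> slides through it because the unit object braids trivially. So
  \<open>T V\<close> differs from the plain pairing by an invertible braiding.\<close>

lemma T_braid: "T V \<cdot> (\<one> N \<otimes> \<sigma> H V) = ev \<otimes> \<one> V"
proof -
  have "T V \<cdot> (\<one> N \<otimes> \<sigma> H V) = (\<one> V \<otimes> ev) \<cdot> \<sigma> (N \<boxtimes> H) V"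
    by (simp add: T_def hexagon_left)
  also have "\<dots> = ev \<otimes> \<one> V"
    using braid_nat[of ev "N \<boxtimes> H" "\<one> V" V \<I> V] by simp
  finally show ?thesis .
qed

text \<open>An action determines its rational coaction, by faithfulness on the side of
  \<open>H\<close>. There \<open>H\<close> stands to the left of \<open>V\<close>, so the inverse
  \<open>b\<close> of \<open>\<sigma> H V\<close> is applied first; for general \<open>V\<close> it
  may differ from \<open>\<sigma> V H\<close>.\<close>

lemma T_cancel:
  assumes [simp]: "Source C x = U" "Target C x = V \<boxtimes> H" "Source C y = U" "Target C y = V \<boxtimes> H"
    and eq: "T V \<cdot> (\<one> N \<otimes> x) = T V \<cdot> (\<one> N \<otimes> y)"
  shows "x = y"
proof -
  obtain b where b [simp]: "Source C b = V \<boxtimes> H" "Target C b = H \<boxtimes> V"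
    and inv: "\<sigma> H V \<cdot> b = \<one> (V \<boxtimes> H)"
    using braid_inverse[where A=H and B=V] by metis
  have *: "(ev \<otimes> \<one> V) \<cdot> (\<one> N \<otimes> (b \<cdot> z)) = T V \<cdot> (\<one> N \<otimes> z)" "\<sigma> H V \<cdot> (b \<cdot> z) = z"
    if [simp]: "Target C z = V \<boxtimes> H" for z
    using comp_tail[OF inv, of z] by (simp_all add: T_braid[symmetric] interchanges)
  have "b \<cdot> x = b \<cdot> y"
    by (rule N.faithful_H[of _ U V]) (simp_all add: hom_iff *(1) eq)
  then show ?thesis
    using *(2)[OF assms(2)] *(2)[OF assms(4)] by (metis (no_types))
qed

section \<open>Contraction in tensor products, and transposing the product of
  \<open>N\<close>\<close>

lemma T_tensor: "T (V \<boxtimes> W) = (\<one> V \<otimes> T W) \<cdot> (\<sigma> N V \<otimes> \<one> (W \<boxtimes> H))"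
  by (simp add: T_def hexagon_right layers del: unit_simps(3))

lemma T_tensor_H: "T (V \<boxtimes> H) \<cdot> (\<one> N \<otimes> \<one> V \<otimes> \<sigma> H H) = T V \<otimes> \<one> H"
proof -
  have "T (V \<boxtimes> H) \<cdot> (\<one> N \<otimes> \<one> V \<otimes> \<sigma> H H)
     = (\<one> V \<otimes> T H) \<cdot> ((\<sigma> N V \<otimes> \<one> (H \<boxtimes> H)) \<cdot> (\<one> (N \<boxtimes> V) \<otimes> \<sigma> H H))"
    by (simp add: T_tensor tensM_assoc flip: tens_ident)
  also have "\<dots> = (\<one> V \<otimes> T H) \<cdot> ((\<one> (V \<boxtimes> N) \<otimes> \<sigma> H H) \<cdot> (\<sigma> N V \<otimes> \<one> (H \<boxtimes> H)))"
    by (simp add: interchange)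
  also have "\<dots> = (\<one> V \<otimes> (T H \<cdot> (\<one> N \<otimes> \<sigma> H H))) \<cdot> (\<sigma> N V \<otimes> \<one> (H \<boxtimes> H))"
    by (simp add: layers del: unit_simps(3))
  also have "\<dots> = T V \<otimes> \<one> H"
    unfolding T_braid by (simp add: T_def layers del: unit_simps(3))
  finally show ?thesis .
qed

text \<open>The pairing of \<open>N \<boxtimes> N\<close> with \<open>H \<boxtimes> H\<close> that
  matches first with first and second with second factors, in elements \<open>g(x) f(y)\<close>.
  Under it \<open>mN\<close> is the transpose of \<open>\<Delta>\<close>.\<close>

definition ev2 where "ev2 = (ev \<otimes> ev) \<cdot> (\<one> N \<otimes> \<sigma> N H \<otimes> \<one> H)"

lemma ev2_ends [simp]: "Source C ev2 = N \<boxtimes> N \<boxtimes> H \<boxtimes> H" "Target C ev2 = \<I>"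
  by (simp_all add: ev2_def)

lemma ev2_T: "ev \<cdot> (\<one> N \<otimes> T H) = ev2"
proof -
  have "ev \<cdot> (\<one> N \<otimes> T H) = (ev \<otimes> \<one> \<I>) \<cdot> ((\<one> N \<otimes> \<one> H) \<otimes> ev) \<cdot> (\<one> N \<otimes> \<sigma> N H \<otimes> \<one> H)"
    by (simp add: T_def layers del: unit_simps(3))
  also have "\<dots> = ev2"
    by (simp add: ev2_def interchange_tail del: unit_simps(2))
  finally show ?thesis .
qed

lemma ev_mult': "ev \<cdot> (mN \<otimes> \<one> H) = ev2 \<cdot> (\<one> N \<otimes> \<one> N \<otimes> \<Delta>)"
  using N.ev_mult by (simp add: ev2_def)

text \<open>This is \<open>ev_mult'\<close> carried past \<open>V\<close>: pairing with a product
  means pairing twice after splitting the \<open>H\<close> component. It turns associativity of an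
  action into coassociativity of its coaction.\<close>

lemma T_mult: "T V \<cdot> (mN \<otimes> \<one> (V \<boxtimes> H)) = T V \<cdot> (\<one> N \<otimes> T (V \<boxtimes> H)) \<cdot> (\<one> N \<otimes> \<one> N \<otimes> \<one> V \<otimes> \<Delta>)"
proof -
  have "T V \<cdot> (mN \<otimes> \<one> (V \<boxtimes> H)) = (\<one> V \<otimes> ev) \<cdot> ((\<sigma> N V \<cdot> (mN \<otimes> \<one> V)) \<otimes> \<one> H)"
    by (simp add: T_def layers del: unit_simps(3))
  also have "\<dots> = (\<one> V \<otimes> (ev \<cdot> (mN \<otimes> \<one> H))) \<cdot> (\<sigma> (N \<boxtimes> N) V \<otimes> \<one> H)"
    by (simp add: braid_nat layers)
  also have "\<dots> = (\<one> V \<otimes> ev2) \<cdot> ((\<one> V \<otimes> \<one> (N \<boxtimes> N) \<otimes> \<Delta>) \<cdot> (\<sigma> (N \<boxtimes> N) V \<otimes> \<one> H))"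
    unfolding ev_mult' by (simp add: layers del: unit_simps(3))
  also have "\<dots> = (\<one> V \<otimes> ev2) \<cdot> (\<sigma> (N \<boxtimes> N) V \<otimes> \<one> (H \<boxtimes> H)) \<cdot> (\<one> (N \<boxtimes> N \<boxtimes> V) \<otimes> \<Delta>)"
    by (simp add: interchange flip: tensM_assoc)
  also have "\<dots> = (\<one> V \<otimes> ev) \<cdot> ((\<one> (V \<boxtimes> N) \<otimes> T H) \<cdot> (\<sigma> N V \<otimes> \<one> (N \<boxtimes> H \<boxtimes> H)))
      \<cdot> (\<one> N \<otimes> \<sigma> N V \<otimes> \<one> (H \<boxtimes> H)) \<cdot> (\<one> (N \<boxtimes> N \<boxtimes> V) \<otimes> \<Delta>)"
    by (simp add: hexagon_left layers ev2_T[symmetric] del: unit_simps(3))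
  also have "(\<one> (V \<boxtimes> N) \<otimes> T H) \<cdot> (\<sigma> N V \<otimes> \<one> (N \<boxtimes> H \<boxtimes> H)) = (\<sigma> N V \<otimes> \<one> H) \<cdot> (\<one> (N \<boxtimes> V) \<otimes> T H)"
    by (simp add: interchange)
  also have "(\<one> V \<otimes> ev) \<cdot> ((\<sigma> N V \<otimes> \<one> H) \<cdot> (\<one> (N \<boxtimes> V) \<otimes> T H)) \<cdot> (\<one> N \<otimes> \<sigma> N V \<otimes> \<one> (H \<boxtimes> H))
      \<cdot> (\<one> (N \<boxtimes> N \<boxtimes> V) \<otimes> \<Delta>)
     = T V \<cdot> (\<one> N \<otimes> T (V \<boxtimes> H)) \<cdot> (\<one> N \<otimes> \<one> N \<otimes> \<one> V \<otimes> \<Delta>)"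
    unfolding T_tensor by (simp add: T_def[of V] layers del: unit_simps(3))
  finally show ?thesis .
qed

lemma T_unit: "T V \<cdot> (\<eta>N \<otimes> \<one> (V \<boxtimes> H)) = \<one> V \<otimes> \<epsilon>"
proof -
  have "T V \<cdot> (\<eta>N \<otimes> \<one> (V \<boxtimes> H)) = (\<one> V \<otimes> ev) \<cdot> ((\<sigma> N V \<cdot> (\<eta>N \<otimes> \<one> V)) \<otimes> \<one> H)"
    by (simp add: T_def layers del: unit_simps(3))
  also have "\<dots> = \<one> V \<otimes> (ev \<cdot> (\<eta>N \<otimes> \<one> H))"
    using braid_nat[of \<eta>N \<I> "\<one> V" V N V] by (simp add: layers)
  finally show ?thesis by (simp add: N.ev_unit)
qed

text \<open>The comodule axioms are the transposes of the module axioms, by \<open>T_mult\<close>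
  and \<open>T_unit\<close>. Coassociativity takes \<open>T_cancel\<close> twice, once for each
  component in \<open>H\<close>.\<close>

lemma rational_comodule:
  assumes M: "left_module_in C N mN \<eta>N M \<alpha>" and [simp]: "Source C \<rho> = M" "Target C \<rho> = M \<boxtimes> H"
    and \<rho>: "T M \<cdot> (\<one> N \<otimes> \<rho>) = \<alpha>"
  shows "hcomodule M \<rho>"
proof
  interpret M: left_module_in C N mN \<eta>N M \<alpha> by fact
  note [simp] = homD[OF M.action_hom]
  show "\<rho> \<in> hom C M (M \<boxtimes> H)" by (simp add: hom_iff)
  have "T M \<cdot> (\<one> N \<otimes> (T (M \<boxtimes> H) \<cdot> (\<one> N \<otimes> ((\<one> M \<otimes> \<Delta>) \<cdot> \<rho>))))
      = (T M \<cdot> (\<one> N \<otimes> T (M \<boxtimes> H)) \<cdot> (\<one> N \<otimes> \<one> N \<otimes> \<one> M \<otimes> \<Delta>)) \<cdot> (\<one> N \<otimes> \<one> N \<otimes> \<rho>)"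
    by (simp add: layers del: unit_simps(3))
  also have "\<dots> = \<alpha> \<cdot> (mN \<otimes> \<one> M)"
    unfolding T_mult[symmetric] \<rho>[symmetric] by (simp add: interchanges flip: tensM_assoc)
  also have "\<dots> = T M \<cdot> (\<one> N \<otimes> (\<rho> \<cdot> \<alpha>))"
    unfolding M.action_mult by (simp add: \<rho>[symmetric] interchanges)
  also have "\<dots> = T M \<cdot> (\<one> N \<otimes> (T (M \<boxtimes> H) \<cdot> (\<one> N \<otimes> \<rho> \<otimes> \<one> H) \<cdot> (\<one> N \<otimes> \<rho>)))"
    using T_natural[of \<rho> M "M \<boxtimes> H"] comp_eq_tail[OF T_natural[of \<rho> M "M \<boxtimes> H"], of "\<one> N \<otimes> \<rho>"]
    by (simp add: \<rho>)
  finally have "T (M \<boxtimes> H) \<cdot> (\<one> N \<otimes> ((\<one> M \<otimes> \<Delta>) \<cdot> \<rho>)) = T (M \<boxtimes> H) \<cdot> (\<one> N \<otimes> \<rho> \<otimes> \<one> H) \<cdot> (\<one> N \<otimes> \<rho>)"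
    by (rule T_cancel[rotated -1]) simp_all
  then show "(\<one> M \<otimes> \<Delta>) \<cdot> \<rho> = (\<rho> \<otimes> \<one> H) \<cdot> \<rho>"
    by - (rule T_cancel[of _ M "M \<boxtimes> H"], simp_all add: whisker)
  have "(\<one> M \<otimes> \<epsilon>) \<cdot> \<rho> = (T M \<cdot> (\<eta>N \<otimes> \<one> (M \<boxtimes> H))) \<cdot> \<rho>"
    by (simp add: T_unit)
  also have "\<dots> = (T M \<cdot> (\<one> N \<otimes> \<rho>)) \<cdot> (\<eta>N \<otimes> \<one> M)"
    using interchange[of "\<one> \<I>" \<eta>N \<rho> "\<one> (M \<boxtimes> H)"] by (simp add: interchange)
  finally show "(\<one> M \<otimes> \<epsilon>) \<cdot> \<rho> = \<one> M"
    by (simp add: \<rho> M.action_unit)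
qed

text \<open>Symmetry of \<open>\<sigma> H H\<close> yields a second formula for \<open>T H\<close>.
  Sliding \<open>ev\<close> through the braiding with \<open>H\<close> shows that the inverse of
  \<open>\<sigma> H N\<close> gives the same pairing as \<open>\<sigma> N H\<close>; faithfulness on
  the side of \<open>N\<close> identifies the two.\<close>

lemma braid_N_H: "\<sigma> H N \<cdot> \<sigma> N H = \<one> (N \<boxtimes> H)" "\<sigma> N H \<cdot> \<sigma> H N = \<one> (H \<boxtimes> N)"
proof -
  obtain b where [simp]: "Source C b = N \<boxtimes> H" "Target C b = H \<boxtimes> N"
    and b: "b \<cdot> \<sigma> H N = \<one> (H \<boxtimes> N)" "\<sigma> H N \<cdot> b = \<one> (N \<boxtimes> H)"
    using braid_inverse[where A=H and B=N] by metis
  have "(ev \<otimes> \<one> H) \<cdot> (\<one> N \<otimes> \<sigma> H H) = T H \<cdot> (\<one> N \<otimes> (\<sigma> H H \<cdot> \<sigma> H H))"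
    unfolding T_braid[symmetric] by (simp add: whisker)
  then have 1: "T H = (ev \<otimes> \<one> H) \<cdot> (\<one> N \<otimes> \<sigma> H H)"
    by (simp add: braid_HH)
  have "(\<one> H \<otimes> ev) \<cdot> (b \<otimes> \<one> H) = (\<sigma> H \<I> \<cdot> (\<one> H \<otimes> ev)) \<cdot> (b \<otimes> \<one> H)"
    by simp
  also have "\<dots> = (ev \<otimes> \<one> H) \<cdot> (\<one> N \<otimes> \<sigma> H H) \<cdot> ((\<sigma> H N \<cdot> b) \<otimes> \<one> H)"
    by (subst braid_nat[of _ H _ "N \<boxtimes> H"]) (simp_all add: hexagon_right whisker)
  also have "\<dots> = T H"
    by (simp add: b 1)
  finally have "b = \<sigma> N H"
    by - (rule N.faithful_dual[of _ "N \<boxtimes> H" H], simp_all add: hom_iff T_def)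
  then show "\<sigma> H N \<cdot> \<sigma> N H = \<one> (N \<boxtimes> H)" "\<sigma> N H \<cdot> \<sigma> H N = \<one> (H \<boxtimes> N)"
    using b by simp_all
qed

text \<open>The augmentation \<open>g \<mapsto> g(1)\<close> of \<open>N\<close>; the integrals are
  the elements on which \<open>N\<close> acts through it.\<close>

abbreviation e where "e \<equiv> ev \<cdot> (\<one> N \<otimes> \<eta>)"

text \<open>The augmentation is an algebra morphism, because \<open>\<Delta>\<close> and
  \<open>\<epsilon>\<close> respect the unit of \<open>H\<close>.\<close>

lemma trivial_module: "left_module_in C N mN \<eta>N Y (e \<otimes> \<one> Y)"
proof
  have "e \<cdot> mN = (ev \<cdot> (mN \<otimes> \<one> H)) \<cdot> (\<one> (N \<boxtimes> N) \<otimes> \<eta>)"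
    using interchange[of "\<one> (N \<boxtimes> N)" mN \<eta> "\<one> H"] interchange[of mN "\<one> N" "\<one> \<I>" \<eta>] by simp
  also have "\<dots> = ev2 \<cdot> (\<one> N \<otimes> \<one> N \<otimes> (\<Delta> \<cdot> \<eta>))"
    unfolding ev_mult' by (simp add: layers del: unit_simps(3))
  also have "\<dots> = (ev \<otimes> ev) \<cdot> ((\<one> N \<otimes> \<sigma> N H \<otimes> \<one> H) \<cdot> (\<one> N \<otimes> (\<one> N \<otimes> \<eta>) \<otimes> \<eta>))"
    unfolding comult_unit ev2_def by (simp add: tensM_assoc flip: tens_ident)
  also have "\<dots> = (ev \<otimes> ev) \<cdot> (\<one> N \<otimes> (\<sigma> N H \<cdot> (\<one> N \<otimes> \<eta>)) \<otimes> \<eta>)"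
    by (simp add: interchange)
  also have "\<dots> = (ev \<otimes> ev) \<cdot> ((\<one> N \<otimes> \<eta>) \<otimes> (\<one> N \<otimes> \<eta>))"
    using braid_nat[of "\<one> N" N \<eta> \<I> N H] by (simp add: tensM_assoc)
  also have "\<dots> = e \<otimes> e"
    by (simp add: interchange)
  finally have mult: "e \<cdot> mN = e \<otimes> e" .
  show "e \<otimes> \<one> Y \<in> hom C (N \<boxtimes> Y) Y"
    by (simp add: hom_iff)
  have "(e \<otimes> \<one> Y) \<cdot> (mN \<otimes> \<one> Y) = (e \<cdot> mN) \<otimes> \<one> Y"
    by (simp add: interchange)
  also have "\<dots> = (e \<otimes> \<one> Y) \<cdot> (\<one> N \<otimes> e \<otimes> \<one> Y)"
    unfolding mult using interchange[of "\<one> N" e "e \<otimes> \<one> Y" "\<one> Y"] by (simp add: tensM_assoc)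
  finally show "(e \<otimes> \<one> Y) \<cdot> (mN \<otimes> \<one> Y) = (e \<otimes> \<one> Y) \<cdot> (\<one> N \<otimes> e \<otimes> \<one> Y)" .
  have "e \<cdot> \<eta>N = (ev \<cdot> (\<eta>N \<otimes> \<one> H)) \<cdot> \<eta>"
    using interchange[of "\<one> \<I>" \<eta>N \<eta> "\<one> H"] interchange[of \<eta>N "\<one> N" "\<one> \<I>" \<eta>] by simp
  then have "e \<cdot> \<eta>N = \<one> \<I>"
    by (simp add: N.ev_unit counit_unit)
  then show "(e \<otimes> \<one> Y) \<cdot> (\<eta>N \<otimes> \<one> Y) = \<one> Y"
    by (simp add: interchange)
qed

text \<open>Pairing with the unit of \<open>H\<close> leaves the scalar \<open>g(1)\<close>, which
  braids trivially past \<open>z\<close>. For \<open>z\<close> an identity this shows that the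
  trivial action is rational.\<close>

lemma T_coinvariant:
  assumes [simp]: "Target C z = V"
  shows "T V \<cdot> (\<one> N \<otimes> z \<otimes> \<eta>) = e \<otimes> z"
proof -
  have "T V \<cdot> (\<one> N \<otimes> z \<otimes> \<eta>) = (\<one> V \<otimes> ev) \<cdot> ((\<sigma> N V \<cdot> (\<one> N \<otimes> z)) \<otimes> \<eta>)"
    by (simp add: T_def interchange flip: tensM_assoc)
  also have "\<dots> = (\<one> V \<otimes> ev) \<cdot> ((z \<otimes> \<one> N) \<otimes> \<eta>) \<cdot> \<sigma> N (Source C z)"
    using interchange[of "\<sigma> N (Source C z)" "z \<otimes> \<one> N" "\<one> \<I>" \<eta>] by (simp add: braid_nat[of _ N z "Source C z"])
  also have "\<dots> = (z \<otimes> e) \<cdot> \<sigma> N (Source C z)"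
    by (simp add: tensM_assoc interchanges)
  also have "\<dots> = e \<otimes> z"
    using braid_nat[of e N z "Source C z" \<I> V] by simp
  finally show ?thesis .
qed

text \<open>Both sides of the coinvariance equation are paired with \<open>N\<close> and pushed into
  \<open>N\<close> along \<open>j\<close>; \<open>T_cancel\<close> and \<open>mono\<close> make this
  reversible. The property \<open>mono\<close> expresses injectivity of \<open>j\<close> by
  morphisms alone.\<close>

lemma coinvariant_iff:
  assumes [simp]: "Source C \<alpha> = N \<boxtimes> M" "Target C \<alpha> = M" "Source C \<rho> = M" "Target C \<rho> = M \<boxtimes> H"
      "Source C j = M" "Target C j = N" "Target C z = M"
    and \<rho>: "T M \<cdot> (\<one> N \<otimes> \<rho>) = \<alpha>"
    and j: "j \<cdot> \<alpha> = mN \<cdot> (\<one> N \<otimes> j)"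
    and mono: "\<And>x y. \<lbrakk>Source C x = Source C y; Target C x = M; Target C y = M; j \<cdot> x = j \<cdot> y\<rbrakk> \<Longrightarrow> x = y"
  shows "\<rho> \<cdot> z = z \<otimes> \<eta> \<longleftrightarrow> mN \<cdot> (\<one> N \<otimes> (j \<cdot> z)) = e \<otimes> (j \<cdot> z)"
proof -
  have 1: "mN \<cdot> (\<one> N \<otimes> (j \<cdot> z)) = j \<cdot> (T M \<cdot> (\<one> N \<otimes> (\<rho> \<cdot> z)))"
  proof -
    have "mN \<cdot> (\<one> N \<otimes> (j \<cdot> z)) = (j \<cdot> \<alpha>) \<cdot> (\<one> N \<otimes> z)"
      unfolding j by (simp add: whisker)
    then show ?thesis
      by (simp add: \<rho>[symmetric] whisker)
  qed
  have 2: "e \<otimes> (j \<cdot> z) = j \<cdot> (T M \<cdot> (\<one> N \<otimes> z \<otimes> \<eta>))"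
    using interchange[of e "\<one> \<I>" z j] by (simp add: T_coinvariant)
  show ?thesis
  proof
    assume "\<rho> \<cdot> z = z \<otimes> \<eta>"
    then show "mN \<cdot> (\<one> N \<otimes> (j \<cdot> z)) = e \<otimes> (j \<cdot> z)"
      unfolding 1 2 by simp
  next
    assume "mN \<cdot> (\<one> N \<otimes> (j \<cdot> z)) = e \<otimes> (j \<cdot> z)"
    then have "T M \<cdot> (\<one> N \<otimes> (\<rho> \<cdot> z)) = T M \<cdot> (\<one> N \<otimes> z \<otimes> \<eta>)"
      unfolding 1 2 by - (rule mono, simp_all)
    then show "\<rho> \<cdot> z = z \<otimes> \<eta>"
      by - (rule T_cancel[of _ "Source C z" M], simp_all)
  qed
qed

text \<open>Precomposing with \<open>\<sigma> N H\<close> cancels the braiding of \<open>H\<close>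
  with \<open>N\<close> in the defining equation, by \<open>braid_N_H\<close>. What remains is
  \<open>x \<mapsto> f(x h)\<close>.\<close>

lemma harpoon_transpose:
  assumes "is_harpoon C H m N ev a"
  shows "ev \<cdot> ((a \<cdot> \<sigma> N H) \<otimes> \<one> H) = ev \<cdot> (\<one> N \<otimes> (m \<cdot> \<sigma> H H))"
proof -
  have [simp]: "Source C a = H \<boxtimes> N" "Target C a = N"
    and a: "ev \<cdot> (a \<otimes> \<one> H) = ev \<cdot> (\<one> N \<otimes> m) \<cdot> (\<one> N \<otimes> \<sigma> H H) \<cdot> (\<sigma> H N \<otimes> \<one> H)"
    using assms by (simp_all add: is_harpoon_def hom_iff)
  have "ev \<cdot> ((a \<cdot> \<sigma> N H) \<otimes> \<one> H) = (ev \<cdot> (a \<otimes> \<one> H)) \<cdot> (\<sigma> N H \<otimes> \<one> H)"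
    by (simp add: whisker)
  also have "\<dots> = ev \<cdot> (\<one> N \<otimes> (m \<cdot> \<sigma> H H)) \<cdot> ((\<sigma> H N \<cdot> \<sigma> N H) \<otimes> \<one> H)"
    unfolding a by (simp add: whisker)
  finally show ?thesis
    by (simp add: braid_N_H)
qed

end

section \<open>The action of \<open>H\<close> on its dual and its compatibility with rational
  coactions\<close>

locale harpoon_action = symmetric_hopf_dual +
  fixes \<gamma> :: 'b
  assumes \<gamma>_ends [simp]: "Source C \<gamma> = N \<boxtimes> H" "Target C \<gamma> = N"
    and \<gamma>: "ev \<cdot> (\<gamma> \<otimes> \<one> H) = ev \<cdot> (\<one> N \<otimes> (m \<cdot> \<sigma> H H))"
begin

text \<open>
  With \<open>\<gamma> = \<rightharpoonup> \<sigma>\<close>, so that \<open>\<gamma> (f \<otimes> h)(x) = f(x h)\<close>, the action of the Hopf module on the dual is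
  \<open>\<beta> (f \<otimes> h)(x) = f(x S(h))\<close>; it is the transpose of \<open>B (h \<otimes> x) = x S(h)\<close>.
\<close>

abbreviation B where "B \<equiv> m \<cdot> \<sigma> H H \<cdot> (S \<otimes> \<one> H)"

definition \<beta> where "\<beta> = \<gamma> \<cdot> (\<one> N \<otimes> S)"

lemma \<beta>_ends [simp]: "Source C \<beta> = N \<boxtimes> H" "Target C \<beta> = N"
  by (simp_all add: \<beta>_def)

lemma \<beta>: "ev \<cdot> (\<beta> \<otimes> \<one> H) = ev \<cdot> (\<one> N \<otimes> B)"
proof -
  have "ev \<cdot> (\<beta> \<otimes> \<one> H) = (ev \<cdot> (\<gamma> \<otimes> \<one> H)) \<cdot> (\<one> N \<otimes> S \<otimes> \<one> H)"
    by (simp add: \<beta>_def layers)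
  then show ?thesis
    unfolding \<gamma> by (simp add: interchanges)
qed

text \<open>Under the pairing the axioms become those of the left action \<open>B\<close> in
  \<open>twist_mult\<close>; transposition changes the side, and faithfulness on the side of
  \<open>N\<close> concludes.\<close>

lemma \<beta>_hmodule: "hmodule N \<beta>"
proof
  show "\<beta> \<in> hom C (N \<boxtimes> H) N"
    by (simp add: hom_iff)
  have "ev \<cdot> ((\<beta> \<cdot> (\<one> N \<otimes> m)) \<otimes> \<one> H) = (ev \<cdot> (\<beta> \<otimes> \<one> H)) \<cdot> (\<one> N \<otimes> m \<otimes> \<one> H)"
    by (simp add: layers)
  also have "\<dots> = ev \<cdot> (\<one> N \<otimes> (B \<cdot> (\<one> H \<otimes> B)))"
    unfolding \<beta> twist_mult(1)[symmetric] by (simp add: interchanges)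
  also have "\<dots> = (ev \<cdot> (\<one> N \<otimes> B)) \<cdot> (\<one> (N \<boxtimes> H) \<otimes> B)"
    by (simp add: layers del: unit_simps(3))
  also have "\<dots> = (ev \<cdot> (\<beta> \<otimes> \<one> H)) \<cdot> (\<one> (N \<boxtimes> H) \<otimes> B)"
    unfolding \<beta> ..
  also have "\<dots> = (ev \<cdot> (\<one> N \<otimes> B)) \<cdot> (\<beta> \<otimes> \<one> (H \<boxtimes> H))"
    by (simp add: interchanges)
  also have "\<dots> = ev \<cdot> ((\<beta> \<cdot> (\<beta> \<otimes> \<one> H)) \<otimes> \<one> H)"
    unfolding \<beta>[symmetric] by (simp add: layers del: unit_simps(3))
  finally show "\<beta> \<cdot> (\<one> N \<otimes> m) = \<beta> \<cdot> (\<beta> \<otimes> \<one> H)"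
    by - (rule N.faithful_dual[of _ "N \<boxtimes> H \<boxtimes> H" \<I>], simp_all add: hom_iff)
  have "ev \<cdot> ((\<beta> \<cdot> (\<one> N \<otimes> \<eta>)) \<otimes> \<one> H) = (ev \<cdot> (\<beta> \<otimes> \<one> H)) \<cdot> (\<one> N \<otimes> \<eta> \<otimes> \<one> H)"
    by (simp add: layers)
  also have "\<dots> = ev \<cdot> (\<one> N \<otimes> (B \<cdot> (\<eta> \<otimes> \<one> H)))"
    unfolding \<beta> by (simp add: interchanges)
  also have "\<dots> = ev"
    unfolding twist_mult(2) by simp
  finally show "\<beta> \<cdot> (\<one> N \<otimes> \<eta>) = \<one> N"
    by - (rule N.faithful_dual[of _ N \<I>], simp_all add: hom_iff)
qed

text \<open>In elements \<open>g(x k) f = \<gamma>(g \<otimes> k)(x) f\<close>: a right factor moves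
  from the argument onto \<open>g\<close>. The double braiding of \<open>f\<close> with
  \<open>k\<close> that arises is trivial by \<open>braid_N_H\<close>.\<close>

lemma T_N_mult: "T N \<cdot> (\<one> N \<otimes> \<one> N \<otimes> m) = T N \<cdot> (\<gamma> \<otimes> \<one> N \<otimes> \<one> H) \<cdot> (\<one> N \<otimes> \<sigma> (N \<boxtimes> H) H)"
proof -
  have 1: "ev \<cdot> (\<one> N \<otimes> m) = ev \<cdot> (\<gamma> \<otimes> \<one> H) \<cdot> (\<one> N \<otimes> \<sigma> H H)"
  proof -
    have "ev \<cdot> (\<gamma> \<otimes> \<one> H) \<cdot> (\<one> N \<otimes> \<sigma> H H) = (ev \<cdot> (\<one> N \<otimes> (m \<cdot> \<sigma> H H))) \<cdot> (\<one> N \<otimes> \<sigma> H H)"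
      unfolding \<gamma>[symmetric] by simp
    also have "\<dots> = ev \<cdot> (\<one> N \<otimes> (m \<cdot> (\<sigma> H H \<cdot> \<sigma> H H)))"
      by (simp add: interchanges)
    finally show ?thesis by (simp add: braid_HH)
  qed
  have "T N \<cdot> (\<gamma> \<otimes> \<one> N \<otimes> \<one> H) \<cdot> (\<one> N \<otimes> \<sigma> (N \<boxtimes> H) H)
      = (\<one> N \<otimes> ev) \<cdot> ((\<sigma> N N \<cdot> (\<gamma> \<otimes> \<one> N)) \<otimes> \<one> H) \<cdot> (\<one> N \<otimes> \<sigma> (N \<boxtimes> H) H)"
    by (simp add: T_def layers del: unit_simps(3))
  also have "\<dots> = (\<one> N \<otimes> ev) \<cdot> (((\<one> N \<otimes> \<gamma>) \<cdot> \<sigma> (N \<boxtimes> H) N) \<otimes> \<one> H) \<cdot> (\<one> N \<otimes> \<sigma> (N \<boxtimes> H) H)"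
    by (simp add: braid_nat)
  also have "\<dots> = (\<one> N \<otimes> ev) \<cdot> (\<one> N \<otimes> \<gamma> \<otimes> \<one> H) \<cdot> (\<sigma> N N \<otimes> \<one> (H \<boxtimes> H)) \<cdot>
      (\<one> N \<otimes> (\<sigma> H N \<cdot> \<sigma> N H) \<otimes> \<one> H) \<cdot> (\<one> (N \<boxtimes> N) \<otimes> \<sigma> H H)"
    by (simp add: hexagon_left layers del: unit_simps(3))
  also have "\<dots> = (\<one> N \<otimes> ev) \<cdot> (\<one> N \<otimes> \<gamma> \<otimes> \<one> H) \<cdot> ((\<sigma> N N \<otimes> \<one> (H \<boxtimes> H)) \<cdot> (\<one> (N \<boxtimes> N) \<otimes> \<sigma> H H))"
    by (simp add: braid_N_H)
  also have "\<dots> = (\<one> N \<otimes> ev) \<cdot> (\<one> N \<otimes> \<gamma> \<otimes> \<one> H) \<cdot> ((\<one> (N \<boxtimes> N) \<otimes> \<sigma> H H) \<cdot> (\<sigma> N N \<otimes> \<one> (H \<boxtimes> H)))"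
    by (simp add: interchange)
  also have "\<dots> = (\<one> N \<otimes> (ev \<cdot> (\<one> N \<otimes> m))) \<cdot> (\<sigma> N N \<otimes> \<one> (H \<boxtimes> H))"
    unfolding 1 by (simp add: layers del: unit_simps(3))
  also have "\<dots> = (\<one> N \<otimes> ev) \<cdot> ((\<one> (N \<boxtimes> N) \<otimes> m) \<cdot> (\<sigma> N N \<otimes> \<one> (H \<boxtimes> H)))"
    by (simp add: layers del: unit_simps(3))
  also have "\<dots> = (\<one> N \<otimes> ev) \<cdot> ((\<sigma> N N \<otimes> \<one> H) \<cdot> (\<one> (N \<boxtimes> N) \<otimes> m))"
    by (simp add: interchange)
  also have "\<dots> = T N \<cdot> (\<one> N \<otimes> \<one> N \<otimes> m)"
    by (simp add: T_def layers del: unit_simps(3))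
  finally show ?thesis ..
qed

text \<open>In elements, the product of \<open>g\<close> and \<open>\<beta>(f \<otimes> h)\<close>
  takes at \<open>x\<close> the value \<open>g(x\<^sub>1) f(x\<^sub>2 S(h))\<close>. Inside the
  pairing stands the left side of \<open>twist_comult\<close>.\<close>

lemma mult_action:
  "(ev \<cdot> (mN \<otimes> \<one> H)) \<cdot> (\<one> N \<otimes> \<beta> \<otimes> \<one> H)
    = ev2 \<cdot> (\<one> N \<otimes> \<one> N \<otimes> ((\<one> H \<otimes> B) \<cdot> (\<sigma> H H \<otimes> \<one> H) \<cdot> (\<one> H \<otimes> \<Delta>)))"
proof -
  have e: "ev \<otimes> ev = ev \<cdot> (\<one> (N \<boxtimes> H) \<otimes> ev)"
    using interchange[of "\<one> (N \<boxtimes> H)" ev ev "\<one> \<I>"] by simp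
  have "(ev \<cdot> (mN \<otimes> \<one> H)) \<cdot> (\<one> N \<otimes> \<beta> \<otimes> \<one> H)
      = ev2 \<cdot> (\<one> N \<otimes> ((\<one> N \<otimes> \<Delta>) \<cdot> (\<beta> \<otimes> \<one> H)))"
    unfolding ev_mult' by (simp add: whisker)
  also have "\<dots> = ev2 \<cdot> (\<one> N \<otimes> ((\<beta> \<otimes> \<one> (H \<boxtimes> H)) \<cdot> (\<one> (N \<boxtimes> H) \<otimes> \<Delta>)))"
    by (simp add: interchange)
  also have "\<dots> = (ev \<otimes> ev) \<cdot> (\<one> N \<otimes> (\<sigma> N H \<cdot> (\<beta> \<otimes> \<one> H)) \<otimes> \<one> H) \<cdot> (\<one> (N \<boxtimes> N \<boxtimes> H) \<otimes> \<Delta>)"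
    by (simp add: ev2_def layers del: unit_simps(3))
  also have "\<dots> = ev \<cdot> (\<one> (N \<boxtimes> H) \<otimes> (ev \<cdot> (\<beta> \<otimes> \<one> H))) \<cdot> (\<one> N \<otimes> \<sigma> (N \<boxtimes> H) H \<otimes> \<one> H)
      \<cdot> (\<one> (N \<boxtimes> N \<boxtimes> H) \<otimes> \<Delta>)"
    by (simp add: braid_nat e layers del: unit_simps(3))
  also have "\<dots> = ((ev \<otimes> ev) \<cdot> (\<one> (N \<boxtimes> H \<boxtimes> N) \<otimes> B)) \<cdot> (\<one> N \<otimes> \<sigma> (N \<boxtimes> H) H \<otimes> \<one> H)
      \<cdot> (\<one> (N \<boxtimes> N \<boxtimes> H) \<otimes> \<Delta>)"
    unfolding \<beta> e by (simp add: layers del: unit_simps(3))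
  also have "\<dots> = (ev \<otimes> ev) \<cdot> ((\<one> (N \<boxtimes> H \<boxtimes> N) \<otimes> B) \<cdot> (\<one> N \<otimes> \<sigma> N H \<otimes> \<one> (H \<boxtimes> H)))
      \<cdot> (\<one> N \<otimes> \<one> N \<otimes> ((\<sigma> H H \<otimes> \<one> H) \<cdot> (\<one> H \<otimes> \<Delta>)))"
    by (simp add: hexagon_left layers del: unit_simps(3))
  also have "(\<one> (N \<boxtimes> H \<boxtimes> N) \<otimes> B) \<cdot> (\<one> N \<otimes> \<sigma> N H \<otimes> \<one> (H \<boxtimes> H))
      = (\<one> N \<otimes> \<sigma> N H \<otimes> \<one> H) \<cdot> (\<one> (N \<boxtimes> N \<boxtimes> H) \<otimes> B)"
    by (simp add: interchange flip: tensM_assoc)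
  finally show ?thesis
    by (simp add: ev2_def layers del: unit_simps(3))
qed

text \<open>The transposition of \<open>\<gamma>\<close> beside a second pair:
  \<open>\<gamma>(g \<otimes> h)(x) f(y) = g(x h) f(y)\<close>.\<close>

lemma ev2_mult:
  "ev2 \<cdot> (\<gamma> \<otimes> \<one> (N \<boxtimes> H \<boxtimes> H)) \<cdot> (\<one> N \<otimes> \<sigma> N H \<otimes> \<one> (H \<boxtimes> H)) = ev2 \<cdot> (\<one> N \<otimes> \<one> N \<otimes> (m \<cdot> \<sigma> H H) \<otimes> \<one> H)"
proof -
  have "ev2 \<cdot> (\<gamma> \<otimes> \<one> (N \<boxtimes> H \<boxtimes> H)) \<cdot> (\<one> N \<otimes> \<sigma> N H \<otimes> \<one> (H \<boxtimes> H))
     = (ev \<otimes> ev) \<cdot> ((\<one> N \<otimes> \<sigma> N H \<otimes> \<one> H) \<cdot> (\<gamma> \<otimes> \<one> (N \<boxtimes> H \<boxtimes> H))) \<cdot> (\<one> N \<otimes> \<sigma> N H \<otimes> \<one> (H \<boxtimes> H))"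
    by (simp add: ev2_def)
  also have "(\<one> N \<otimes> \<sigma> N H \<otimes> \<one> H) \<cdot> (\<gamma> \<otimes> \<one> (N \<boxtimes> H \<boxtimes> H))
      = (\<gamma> \<otimes> \<one> (H \<boxtimes> N \<boxtimes> H)) \<cdot> (\<one> (N \<boxtimes> H) \<otimes> \<sigma> N H \<otimes> \<one> H)"
    by (simp add: interchange)
  also have "(ev \<otimes> ev) \<cdot> ((\<gamma> \<otimes> \<one> (H \<boxtimes> N \<boxtimes> H)) \<cdot> (\<one> (N \<boxtimes> H) \<otimes> \<sigma> N H \<otimes> \<one> H))
      \<cdot> (\<one> N \<otimes> \<sigma> N H \<otimes> \<one> (H \<boxtimes> H))
     = ((ev \<cdot> (\<gamma> \<otimes> \<one> H)) \<otimes> ev) \<cdot> (\<one> N \<otimes> \<sigma> N (H \<boxtimes> H) \<otimes> \<one> H)"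
  proof -
    have "(ev \<otimes> ev) \<cdot> (\<gamma> \<otimes> \<one> (H \<boxtimes> N \<boxtimes> H)) = (ev \<cdot> (\<gamma> \<otimes> \<one> H)) \<otimes> ev"
      using interchange[of "\<gamma> \<otimes> \<one> H" ev "\<one> (N \<boxtimes> H)" ev] by (simp add: tensM_assoc)
    from comp_tail[OF this] show ?thesis
      by (simp add: hexagon_right layers del: unit_simps(3))
  qed
  also have "\<dots> = (ev \<otimes> ev) \<cdot> (\<one> N \<otimes> (((m \<cdot> \<sigma> H H) \<otimes> \<one> N) \<cdot> \<sigma> N (H \<boxtimes> H)) \<otimes> \<one> H)"
  proof -
    have "(ev \<otimes> ev) \<cdot> (\<one> N \<otimes> (m \<cdot> \<sigma> H H) \<otimes> \<one> (N \<boxtimes> H)) = (ev \<cdot> (\<one> N \<otimes> (m \<cdot> \<sigma> H H))) \<otimes> ev"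
      using interchange[of "\<one> N \<otimes> (m \<cdot> \<sigma> H H)" ev "\<one> (N \<boxtimes> H)" ev] by (simp add: tensM_assoc)
    from comp_tail[OF this] show ?thesis
      unfolding \<gamma> by (simp add: layers del: unit_simps(3))
  qed
  also have "((m \<cdot> \<sigma> H H) \<otimes> \<one> N) \<cdot> \<sigma> N (H \<boxtimes> H) = \<sigma> N H \<cdot> (\<one> N \<otimes> (m \<cdot> \<sigma> H H))"
    by (subst braid_nat[of "\<one> N" N "m \<cdot> \<sigma> H H" "H \<boxtimes> H"]) simp_all
  finally show ?thesis
    by (simp add: ev2_def layers del: unit_simps(3))
qed

text \<open>With \<open>\<theta>(f) = f\<^sub>0 \<otimes> f\<^sub>1\<close>, the right side is
  \<open>g(f\<^sub>1 h\<^sub>2) \<beta>(f\<^sub>0 \<otimes> h\<^sub>1)\<close>, which equals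
  \<open>\<beta>(\<gamma>(g \<otimes> h\<^sub>2) f \<otimes> h\<^sub>1)\<close>. At \<open>x\<close>
  it takes the value \<open>g((x S(h\<^sub>1))\<^sub>1 h\<^sub>2) f((x
  S(h\<^sub>1))\<^sub>2)\<close>, and \<open>twist_comult\<close> turns this into
  \<open>g(x\<^sub>1) f(x\<^sub>2 S(h))\<close>, the value of the left side.\<close>

lemma dual_coaction_action:
  assumes [simp]: "Source C \<theta> = M" "Target C \<theta> = N \<boxtimes> H" "Source C j = M" "Target C j = N"
    and \<theta>: "T N \<cdot> (\<one> N \<otimes> \<theta>) = mN \<cdot> (\<one> N \<otimes> j)"
  shows "mN \<cdot> (\<one> N \<otimes> (\<beta> \<cdot> (j \<otimes> \<one> H)))
    = T N \<cdot> (\<one> N \<otimes> ((\<beta> \<otimes> m) \<cdot> (\<one> N \<otimes> \<sigma> H H \<otimes> \<one> H) \<cdot> (\<theta> \<otimes> \<Delta>)))" (is "?L = T N \<cdot> (\<one> N \<otimes> ?Z)")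
proof -
  let ?J = "\<one> N \<otimes> j \<otimes> \<one> H"
  let ?K = "mN \<cdot> (\<gamma> \<otimes> \<one> N) \<cdot> (\<one> N \<otimes> \<sigma> N H)"
  \<comment> \<open>Since \<open>g(f\<^sub>1 k) f\<^sub>0 = \<gamma>(g \<otimes> k)(f\<^sub>1)
    f\<^sub>0\<close>, the assumption on \<open>\<theta>\<close> makes this the product
    \<open>\<gamma>(g \<otimes> k) f\<close>.\<close>
  have K: "T N \<cdot> (\<one> N \<otimes> \<one> N \<otimes> m) \<cdot> (\<one> N \<otimes> \<theta> \<otimes> \<one> H) = ?K \<cdot> ?J"
  proof -
    have "T N \<cdot> (\<one> N \<otimes> \<one> N \<otimes> m) \<cdot> (\<one> N \<otimes> \<theta> \<otimes> \<one> H)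
      = T N \<cdot> (\<gamma> \<otimes> \<one> (N \<boxtimes> H)) \<cdot> (\<one> N \<otimes> (\<sigma> (N \<boxtimes> H) H \<cdot> (\<theta> \<otimes> \<one> H)))"
      using comp_eq_tail[OF T_N_mult, of "\<one> N \<otimes> \<theta> \<otimes> \<one> H"] by (simp add: whisker)
    also have "\<dots> = T N \<cdot> ((\<gamma> \<otimes> \<one> (N \<boxtimes> H)) \<cdot> (\<one> (N \<boxtimes> H) \<otimes> \<theta>)) \<cdot> (\<one> N \<otimes> \<sigma> M H)"
      by (simp add: braid_nat layers del: unit_simps(3))
    also have "\<dots> = (T N \<cdot> (\<one> N \<otimes> \<theta>)) \<cdot> (\<gamma> \<otimes> \<one> M) \<cdot> (\<one> N \<otimes> \<sigma> M H)"
      by (simp add: interchange interchange_tail)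
    also have "\<dots> = mN \<cdot> ((\<one> N \<otimes> j) \<cdot> (\<gamma> \<otimes> \<one> M)) \<cdot> (\<one> N \<otimes> \<sigma> M H)"
      unfolding \<theta> by simp
    also have "(\<one> N \<otimes> j) \<cdot> (\<gamma> \<otimes> \<one> M) = (\<gamma> \<otimes> \<one> N) \<cdot> (\<one> (N \<boxtimes> H) \<otimes> j)"
      by (simp add: interchange)
    also have "mN \<cdot> ((\<gamma> \<otimes> \<one> N) \<cdot> (\<one> (N \<boxtimes> H) \<otimes> j)) \<cdot> (\<one> N \<otimes> \<sigma> M H)
        = mN \<cdot> (\<gamma> \<otimes> \<one> N) \<cdot> (\<one> N \<otimes> ((\<one> H \<otimes> j) \<cdot> \<sigma> M H))"
      by (simp add: layers del: unit_simps(3))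
    also have "(\<one> H \<otimes> j) \<cdot> \<sigma> M H = \<sigma> N H \<cdot> (j \<otimes> \<one> H)"
      by (simp add: braid_nat)
    finally show ?thesis by (simp add: whisker)
  qed
  have TH: "T (N \<boxtimes> H) = (T N \<otimes> \<one> H) \<cdot> (\<one> N \<otimes> \<one> N \<otimes> \<sigma> H H)"
    unfolding T_tensor_H[symmetric] by (simp add: interchange braid_HH)
  have mc: "\<sigma> H H \<cdot> (\<one> H \<otimes> m) \<cdot> (\<sigma> H H \<otimes> \<one> H) = (m \<otimes> \<one> H) \<cdot> (\<one> H \<otimes> \<sigma> H H)"
  proof -
    have "\<sigma> H H \<cdot> (\<one> H \<otimes> m) \<cdot> (\<sigma> H H \<otimes> \<one> H) = (m \<otimes> \<one> H) \<cdot> \<sigma> H (H \<boxtimes> H) \<cdot> (\<sigma> H H \<otimes> \<one> H)"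
      by (rule braid_nat_tail) simp_all
    then show ?thesis
      by (simp add: hexagon_right interchange braid_HH)
  qed
  \<comment> \<open>The component \<open>h\<^sub>1\<close> goes to the far right, to act last, while
    \<open>f\<^sub>1 h\<^sub>2\<close> stands where it is paired; hence the opposite coproduct
    \<open>\<sigma> H H \<cdot> \<Delta>\<close>.\<close>
  have W: "(\<one> N \<otimes> \<sigma> H H) \<cdot> (\<one> (N \<boxtimes> H) \<otimes> m) \<cdot> (\<one> N \<otimes> \<sigma> H H \<otimes> \<one> H) \<cdot> (\<theta> \<otimes> \<Delta>)
      = (\<one> N \<otimes> m \<otimes> \<one> H) \<cdot> (\<theta> \<otimes> (\<sigma> H H \<cdot> \<Delta>))"
  proof -
    have "(\<one> N \<otimes> \<sigma> H H) \<cdot> (\<one> (N \<boxtimes> H) \<otimes> m) \<cdot> (\<one> N \<otimes> \<sigma> H H \<otimes> \<one> H) \<cdot> (\<theta> \<otimes> \<Delta>)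
        = (\<one> N \<otimes> (\<sigma> H H \<cdot> (\<one> H \<otimes> m) \<cdot> (\<sigma> H H \<otimes> \<one> H))) \<cdot> (\<theta> \<otimes> \<Delta>)"
      by (simp add: layers del: unit_simps(3))
    also have "\<dots> = (\<one> N \<otimes> m \<otimes> \<one> H) \<cdot> ((\<one> (N \<boxtimes> H) \<otimes> \<sigma> H H) \<cdot> (\<theta> \<otimes> \<Delta>))"
      unfolding mc by (simp add: layers del: unit_simps(3))
    finally show ?thesis
      by (simp add: interchange)
  qed
  have \<beta>m: "\<beta> \<otimes> m = (\<beta> \<otimes> \<one> H) \<cdot> (\<one> (N \<boxtimes> H) \<otimes> m)"
    by (simp add: interchange)
  have "T N \<cdot> (\<one> N \<otimes> ?Z) = (T N \<cdot> (\<one> N \<otimes> \<beta> \<otimes> \<one> H)) \<cdot>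
      (\<one> N \<otimes> ((\<one> (N \<boxtimes> H) \<otimes> m) \<cdot> (\<one> N \<otimes> \<sigma> H H \<otimes> \<one> H) \<cdot> (\<theta> \<otimes> \<Delta>)))"
    unfolding \<beta>m by (simp add: whisker)
  also have "\<dots> = \<beta> \<cdot> (T N \<otimes> \<one> H) \<cdot> (\<one> N \<otimes> ((\<one> N \<otimes> m \<otimes> \<one> H) \<cdot> (\<theta> \<otimes> (\<sigma> H H \<cdot> \<Delta>))))"
    unfolding W[symmetric] by (simp add: T_natural TH whisker)
  also have "\<dots> = \<beta> \<cdot> (T N \<otimes> \<one> H) \<cdot> (\<one> N \<otimes> \<one> N \<otimes> m \<otimes> \<one> H) \<cdot> (\<one> N \<otimes> ((\<theta> \<otimes> \<one> (H \<boxtimes> H)) \<cdot> (\<one> M \<otimes> (\<sigma> H H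
      \<cdot> \<Delta>))))"
    by (simp add: interchange_tail interchange)
  also have "\<dots> = \<beta> \<cdot> ((T N \<cdot> (\<one> N \<otimes> \<one> N \<otimes> m) \<cdot> (\<one> N \<otimes> \<theta> \<otimes> \<one> H)) \<otimes> \<one> H) \<cdot> (\<one> N \<otimes> \<one> M \<otimes> (\<sigma> H H \<cdot> \<Delta>))"
    by (simp add: layers del: unit_simps(3))
  finally have R: "T N \<cdot> (\<one> N \<otimes> ?Z) = \<beta> \<cdot> ((?K \<cdot> ?J) \<otimes> \<one> H) \<cdot> (\<one> N \<otimes> \<one> M \<otimes> (\<sigma> H H \<cdot> \<Delta>))"
    unfolding K .
  \<comment> \<open>In elements
    \<open>(\<gamma>(g \<otimes> k) f)(y) = g(y\<^sub>1 k) f(y\<^sub>2)\<close>.\<close>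
  have evK: "ev \<cdot> (?K \<otimes> \<one> H) = ev2 \<cdot> (\<one> N \<otimes> \<one> N \<otimes> (((m \<cdot> \<sigma> H H) \<otimes> \<one> H) \<cdot> (\<one> H \<otimes> \<Delta>)))"
  proof -
    have "ev \<cdot> (?K \<otimes> \<one> H) = ev2 \<cdot> ((\<one> (N \<boxtimes> N) \<otimes> \<Delta>) \<cdot> (((\<gamma> \<otimes> \<one> N) \<cdot> (\<one> N \<otimes> \<sigma> N H)) \<otimes> \<one> H))"
      using comp_eq_tail[OF ev_mult', of "((\<gamma> \<otimes> \<one> N) \<cdot> (\<one> N \<otimes> \<sigma> N H)) \<otimes> \<one> H"]
      by (simp add: layers del: unit_simps(3))
    also have "\<dots> = ev2 \<cdot> ((((\<gamma> \<otimes> \<one> N) \<cdot> (\<one> N \<otimes> \<sigma> N H)) \<otimes> \<one> (H \<boxtimes> H)) \<cdot> (\<one> (N \<boxtimes> N \<boxtimes> H) \<otimes> \<Delta>))"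
      by (simp add: interchange)
    also have "\<dots> = (ev2 \<cdot> (\<gamma> \<otimes> \<one> (N \<boxtimes> H \<boxtimes> H)) \<cdot> (\<one> N \<otimes> \<sigma> N H \<otimes> \<one> (H \<boxtimes> H))) \<cdot> (\<one> (N \<boxtimes> N \<boxtimes> H) \<otimes> \<Delta>)"
      by (simp add: layers del: unit_simps(3))
    finally show ?thesis
      unfolding ev2_mult by (simp add: layers del: unit_simps(3))
  qed
  have "ev \<cdot> ((T N \<cdot> (\<one> N \<otimes> ?Z)) \<otimes> \<one> H) = (ev \<cdot> (\<beta> \<otimes> \<one> H)) \<cdot> (?K \<otimes> \<one> (H \<boxtimes> H)) \<cdot>
      (?J \<otimes> \<one> (H \<boxtimes> H)) \<cdot> (\<one> N \<otimes> \<one> M \<otimes> (\<sigma> H H \<cdot> \<Delta>) \<otimes> \<one> H)"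
    unfolding R by (simp add: layers del: unit_simps(3))
  also have "\<dots> = ev \<cdot> ((\<one> N \<otimes> B) \<cdot> (?K \<otimes> \<one> (H \<boxtimes> H))) \<cdot>
      (?J \<otimes> \<one> (H \<boxtimes> H)) \<cdot> (\<one> N \<otimes> \<one> M \<otimes> (\<sigma> H H \<cdot> \<Delta>) \<otimes> \<one> H)"
    unfolding \<beta> by simp
  also have "(\<one> N \<otimes> B) \<cdot> (?K \<otimes> \<one> (H \<boxtimes> H)) = (?K \<otimes> \<one> H) \<cdot> (\<one> (N \<boxtimes> N \<boxtimes> H) \<otimes> B)"
    by (simp add: interchange)
  also have "(?J \<otimes> \<one> (H \<boxtimes> H)) \<cdot> (\<one> N \<otimes> \<one> M \<otimes> (\<sigma> H H \<cdot> \<Delta>) \<otimes> \<one> H)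
      = (\<one> N \<otimes> \<one> N \<otimes> (\<sigma> H H \<cdot> \<Delta>) \<otimes> \<one> H) \<cdot> (\<one> N \<otimes> j \<otimes> \<one> (H \<boxtimes> H))"
    by (simp add: interchange tensM_assoc)
  also have "ev \<cdot> ((?K \<otimes> \<one> H) \<cdot> (\<one> (N \<boxtimes> N \<boxtimes> H) \<otimes> B)) \<cdot>
      (\<one> N \<otimes> \<one> N \<otimes> (\<sigma> H H \<cdot> \<Delta>) \<otimes> \<one> H) \<cdot> (\<one> N \<otimes> j \<otimes> \<one> (H \<boxtimes> H))
      = ev2 \<cdot> (\<one> N \<otimes> \<one> N \<otimes> (((m \<cdot> \<sigma> H H) \<otimes> \<one> H) \<cdot> (\<one> H \<otimes> (\<Delta> \<cdot> B)) \<cdot> ((\<sigma> H H \<cdot> \<Delta>) \<otimes> \<one> H)))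
         \<cdot> (\<one> N \<otimes> j \<otimes> \<one> (H \<boxtimes> H))"
  proof -
    have "ev \<cdot> ((?K \<otimes> \<one> H) \<cdot> (\<one> (N \<boxtimes> N \<boxtimes> H) \<otimes> B)) \<cdot>
      (\<one> N \<otimes> \<one> N \<otimes> (\<sigma> H H \<cdot> \<Delta>) \<otimes> \<one> H) \<cdot> (\<one> N \<otimes> j \<otimes> \<one> (H \<boxtimes> H))
      = (ev \<cdot> (?K \<otimes> \<one> H)) \<cdot> (\<one> (N \<boxtimes> N \<boxtimes> H) \<otimes> B) \<cdot>
      (\<one> N \<otimes> \<one> N \<otimes> (\<sigma> H H \<cdot> \<Delta>) \<otimes> \<one> H) \<cdot> (\<one> N \<otimes> j \<otimes> \<one> (H \<boxtimes> H))"
      by simp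
    then show ?thesis
      unfolding evK by (simp add: layers del: unit_simps(3))
  qed
  also have "\<dots> = ((ev \<cdot> (mN \<otimes> \<one> H)) \<cdot> (\<one> N \<otimes> \<beta> \<otimes> \<one> H)) \<cdot> (\<one> N \<otimes> j \<otimes> \<one> (H \<boxtimes> H))"
    unfolding mult_action twist_comult by simp
  also have "\<dots> = ev \<cdot> (?L \<otimes> \<one> H)"
    by (simp add: layers del: unit_simps(3))
  finally show ?thesis
    by - (rule N.faithful_dual[of _ "N \<boxtimes> M \<boxtimes> H" \<I>], simp_all add: hom_iff)
qed

text \<open>The module axioms are pulled back from \<open>\<beta>\<close> along \<open>j\<close>,
  the comodule axioms come from rationality. For the compatibility both sides are paired with
  \<open>N\<close> and sent along \<open>j\<close>, which leaves \<open>dual_coaction_action\<close>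
  for the coaction \<open>(j \<otimes> \<one> H) \<cdot> \<rho>\<close>.\<close>

lemma rational_hopf_module:
  assumes M: "left_module_in C N mN \<eta>N M \<alpha>"
    and [simp]: "Source C \<rho> = M" "Target C \<rho> = M \<boxtimes> H" "Source C j = M" "Target C j = N"
      "Source C b = M \<boxtimes> H" "Target C b = M"
    and \<rho>: "T M \<cdot> (\<one> N \<otimes> \<rho>) = \<alpha>"
    and j: "j \<cdot> \<alpha> = mN \<cdot> (\<one> N \<otimes> j)"
    and mono: "\<And>x y. \<lbrakk>Source C x = Source C y; Target C x = M; Target C y = M; j \<cdot> x = j \<cdot> y\<rbrakk> \<Longrightarrow> x = y"
    and b: "j \<cdot> b = \<beta> \<cdot> (j \<otimes> \<one> H)"
  shows "hopf_mod M b \<rho>"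
proof (intro hopf_module.intro hopf_module_axioms.intro)
  note [simp] = homD[OF left_module_in.action_hom[OF M]]
  show "hcomodule M \<rho>"
    by (rule rational_comodule[OF M]) (simp_all add: \<rho>)
  interpret N': right_module_in C H m \<eta> N \<beta>
    by (rule \<beta>_hmodule)
  have bt: "j \<cdot> (b \<cdot> x) = \<beta> \<cdot> ((j \<otimes> \<one> H) \<cdot> x)" if "Target C x = M \<boxtimes> H" for x
    by (rule comp_eq_tail[OF b]) (simp_all add: that)
  show "hmodule M b"
  proof
    show "b \<in> hom C (M \<boxtimes> H) M" by (simp add: hom_iff)
    have "j \<cdot> (b \<cdot> (\<one> M \<otimes> m)) = (\<beta> \<cdot> (\<one> N \<otimes> m)) \<cdot> (j \<otimes> \<one> (H \<boxtimes> H))"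
      by (simp add: bt interchange)
    also have "\<dots> = \<beta> \<cdot> ((\<beta> \<cdot> (j \<otimes> \<one> H)) \<otimes> \<one> H)"
      unfolding N'.action_mult by (simp add: layers del: unit_simps(3))
    also have "\<dots> = j \<cdot> (b \<cdot> (b \<otimes> \<one> H))"
      by (simp add: bt b[symmetric] whisker)
    finally show "b \<cdot> (\<one> M \<otimes> m) = b \<cdot> (b \<otimes> \<one> H)"
      by - (rule mono, simp_all)
    have "j \<cdot> (b \<cdot> (\<one> M \<otimes> \<eta>)) = (\<beta> \<cdot> (\<one> N \<otimes> \<eta>)) \<cdot> j"
      using interchange[of j "\<one> N" "\<one> \<I>" \<eta>] by (simp add: bt interchange)
    then have "j \<cdot> (b \<cdot> (\<one> M \<otimes> \<eta>)) = j \<cdot> \<one> M"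
      by (simp add: N'.action_unit)
    then show "b \<cdot> (\<one> M \<otimes> \<eta>) = \<one> M"
      by - (rule mono, simp_all)
  qed
  let ?Z = "(b \<otimes> m) \<cdot> (\<one> M \<otimes> \<sigma> H H \<otimes> \<one> H) \<cdot> (\<rho> \<otimes> \<Delta>)"
  let ?\<theta> = "(j \<otimes> \<one> H) \<cdot> \<rho>"
  have jT: "j \<cdot> (T M \<cdot> x) = T N \<cdot> ((\<one> N \<otimes> j \<otimes> \<one> H) \<cdot> x)" if "Target C x = N \<boxtimes> M \<boxtimes> H" for x
    by (rule comp_eq_tail[OF T_natural[symmetric]]) (simp_all add: that)
  have \<theta>: "T N \<cdot> (\<one> N \<otimes> ?\<theta>) = mN \<cdot> (\<one> N \<otimes> j)"
    unfolding j[symmetric] \<rho>[symmetric] by (simp add: jT whisker)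
  have "j \<cdot> (T M \<cdot> (\<one> N \<otimes> (\<rho> \<cdot> b))) = (j \<cdot> \<alpha>) \<cdot> (\<one> N \<otimes> b)"
    unfolding \<rho>[symmetric] by (simp add: whisker)
  also have "\<dots> = mN \<cdot> (\<one> N \<otimes> (\<beta> \<cdot> (j \<otimes> \<one> H)))"
    unfolding j b[symmetric] by (simp add: whisker)
  also have "\<dots> = T N \<cdot> (\<one> N \<otimes> ((\<beta> \<otimes> m) \<cdot> (\<one> N \<otimes> \<sigma> H H \<otimes> \<one> H) \<cdot> (?\<theta> \<otimes> \<Delta>)))"
    by (rule dual_coaction_action) (simp_all add: \<theta>)
  also have "(\<beta> \<otimes> m) \<cdot> (\<one> N \<otimes> \<sigma> H H \<otimes> \<one> H) \<cdot> (?\<theta> \<otimes> \<Delta>) = (j \<otimes> \<one> H) \<cdot> ?Z"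
  proof -
    have "(\<beta> \<otimes> m) \<cdot> (\<one> N \<otimes> \<sigma> H H \<otimes> \<one> H) \<cdot> (?\<theta> \<otimes> \<Delta>)
        = (\<beta> \<otimes> m) \<cdot> ((\<one> N \<otimes> (\<sigma> H H \<otimes> \<one> H)) \<cdot> (j \<otimes> \<one> (H \<boxtimes> H \<boxtimes> H))) \<cdot> (\<rho> \<otimes> \<Delta>)"
      using interchange[of \<rho> "j \<otimes> \<one> H" \<Delta> "\<one> (H \<boxtimes> H)"] by (simp add: tensM_assoc)
    also have "(\<one> N \<otimes> (\<sigma> H H \<otimes> \<one> H)) \<cdot> (j \<otimes> \<one> (H \<boxtimes> H \<boxtimes> H))
        = ((j \<otimes> \<one> H) \<otimes> \<one> (H \<boxtimes> H)) \<cdot> (\<one> M \<otimes> \<sigma> H H \<otimes> \<one> H)"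
      by (simp add: interchange tensM_assoc)
    also have "(\<beta> \<otimes> m) \<cdot> (((j \<otimes> \<one> H) \<otimes> \<one> (H \<boxtimes> H)) \<cdot> (\<one> M \<otimes> \<sigma> H H \<otimes> \<one> H)) \<cdot> (\<rho> \<otimes> \<Delta>)
        = ((j \<cdot> b) \<otimes> m) \<cdot> (\<one> M \<otimes> \<sigma> H H \<otimes> \<one> H) \<cdot> (\<rho> \<otimes> \<Delta>)"
      by (simp add: interchange_tail[of _ \<beta>] b)
    finally show ?thesis
      by (simp add: interchange_tail)
  qed
  also have "T N \<cdot> (\<one> N \<otimes> ((j \<otimes> \<one> H) \<cdot> ?Z)) = j \<cdot> (T M \<cdot> (\<one> N \<otimes> ?Z))"
    by (simp add: jT whisker)
  finally have "T M \<cdot> (\<one> N \<otimes> (\<rho> \<cdot> b)) = T M \<cdot> (\<one> N \<otimes> ?Z)"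
    by - (rule mono, simp_all)
  then show "\<rho> \<cdot> b = ?Z"
    by - (rule T_cancel[of _ "M \<boxtimes> H" M], simp_all)
qed

end

section \<open>Elements of objects\<close>

context forgetful_functor
begin

lemma Mp_in: "\<lbrakk>f \<in> hom C U V; u \<in> Sp F U\<rbrakk> \<Longrightarrow> Mp F f u \<in> Sp F V"
  using Mp_linear by (auto simp: linear_on_def)

lemma subobject_mono:
  assumes i: "subobject C F X Y i" and x: "x \<in> hom C U Y" "y \<in> hom C U Y" and eq: "i \<cdot> x = i \<cdot> y"
  shows "x = y"
proof (rule Mp_faithful[OF x])
  fix u assume u: "u \<in> Sp F U"
  have i': "i \<in> hom C Y X" "inj_on (Mp F i) (Sp F Y)"
    using i by (auto simp: subobject_def)
  have "Mp F i (Mp F x u) = Mp F i (Mp F y u)"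
    using Mp_comp[OF x(1) i'(1) u] Mp_comp[OF x(2) i'(1) u] eq by simp
  then show "Mp F x u = Mp F y u"
    using i'(2) Mp_in[OF x(1) u] Mp_in[OF x(2) u] by (auto dest: inj_onD)
qed

text \<open>A forgetful functor may fail to preserve equalizers, but a retraction inverts the
  underlying map on its image. This will show that the equalizer splitting \<open>P\<close> is a
  subobject.\<close>

lemma subobject_split:
  assumes i: "i \<in> hom C Y X" and p: "p \<in> hom C X Y" and pi: "p \<cdot> i = \<one> Y"
  shows "subobject C F X Y i"
  unfolding subobject_def
proof (intro conjI i inj_on_inverseI)
  show "Mp F p (Mp F i u) = u" if "u \<in> Sp F Y" for u
    using Mp_comp[OF i p that] Mp_ident[OF that] pi by simp
qed

lemma subobject_comp:
  assumes i: "subobject C F X Y i" and j: "subobject C F Z X j"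
  shows "subobject C F Z Y (j \<cdot> i)"
proof -
  have h: "i \<in> hom C Y X" "j \<in> hom C X Z" and inj: "inj_on (Mp F i) (Sp F Y)" "inj_on (Mp F j) (Sp F X)"
    using i j by (auto simp: subobject_def)
  have "inj_on (Mp F j \<circ> Mp F i) (Sp F Y)"
    using inj Mp_in[OF h(1)] by (auto intro!: comp_inj_on inj_on_subset[OF inj(2)])
  moreover have "inj_on (Mp F (j \<cdot> i)) (Sp F Y) = inj_on (Mp F j \<circ> Mp F i) (Sp F Y)"
    by (rule inj_on_cong) (simp add: Mp_comp[OF h])
  ultimately show ?thesis
    using comp_hom[OF h] by (simp add: subobject_def)
qed

lemma Tens_in: "\<lbrakk>u \<in> Sp F U; v \<in> Sp F V\<rbrakk> \<Longrightarrow> Tens F U V u v \<in> Sp F (U \<boxtimes> V)"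
  using Sp_tens[of U V] by (auto simp: is_tensor_product_def bilinear_on_def linear_on_def)

text \<open>The uniqueness half of the universal property: both underlying linear maps factor the
  same bilinear map, the restriction of \<open>f\<close> to pure tensors.\<close>

lemma tensor_ext:
  assumes f: "f \<in> hom C (U \<boxtimes> V) W" and g: "g \<in> hom C (U \<boxtimes> V) W"
    and eq: "\<And>u v. \<lbrakk>u \<in> Sp F U; v \<in> Sp F V\<rbrakk> \<Longrightarrow> Mp F f (Tens F U V u v) = Mp F g (Tens F U V u v)"
  shows "f = g"
proof (rule Mp_faithful[OF f g])
  fix x assume x: "x \<in> Sp F (U \<boxtimes> V)"
  let ?b = "\<lambda>u v. Mp F f (Tens F U V u v)"
  note lf = Mp_linear[OF f, unfolded linear_on_def]
  have t: "bilinear_on (Smult F) (Sp F U) (Sp F V) (Sp F (U \<boxtimes> V)) (Tens F U V)"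
    using Sp_tens[of U V] by (simp add: is_tensor_product_def)
  have b: "bilinear_on (Smult F) (Sp F U) (Sp F V) (Sp F W) ?b"
    using t lf Tens_in unfolding bilinear_on_def linear_on_def by simp
  obtain \<gamma> where \<gamma>: "\<forall>\<gamma>'. linear_on (Smult F) (Sp F (U \<boxtimes> V)) (Sp F W) \<gamma>' \<and>
      (\<forall>v\<in>Sp F U. \<forall>w\<in>Sp F V. \<gamma>' (Tens F U V v w) = ?b v w) \<longrightarrow> (\<forall>x\<in>Sp F (U \<boxtimes> V). \<gamma>' x = \<gamma> x)"
    using Sp_tens[of U V, unfolded is_tensor_product_def, THEN conjunct2, THEN spec, THEN spec,
      THEN mp, THEN mp, OF Sp_subspace b] by (elim exE conjE)
  have "Mp F f x = \<gamma> x"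
    using \<gamma>[THEN spec, of "Mp F f"] Mp_linear[OF f] x by simp
  moreover have "Mp F g x = \<gamma> x"
    using \<gamma>[THEN spec, of "Mp F g"] Mp_linear[OF g] eq x by simp
  ultimately show "Mp F f x = Mp F g x"
    by simp
qed

lemma to_scalar_Smult: "to_scalar F (Smult F c (One F)) = c"
  unfolding to_scalar_def using One_nonzero scale_right_imp_eq by blast

lemma unit_action:
  assumes x: "x \<in> Sp F \<I>" and u: "u \<in> Sp F U"
  shows "Tens F \<I> U x u = Smult F (to_scalar F x) u"
proof -
  obtain c where c: "x = Smult F c (One F)"
    using x Sp_unit by auto
  have "One F \<in> Sp F \<I>"
    unfolding Sp_unit by (rule range_eqI[of _ _ 1]) simp
  then show ?thesis
    using Sp_tens[of \<I> U] u Tens_unit(1)[OF u]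
    by (simp add: c to_scalar_Smult is_tensor_product_def bilinear_on_def linear_on_def)
qed

text \<open>On a pure tensor \<open>g \<otimes> u\<close> the two morphisms give
  \<open>g y(u)\<close> and \<open>g(1) y(u)\<close>. The condition on elements thus becomes an
  equation in the category, of the form found in \<open>coinvariant_iff\<close>.\<close>

lemma integrals_iff:
  assumes mN: "mN \<in> hom C (N \<boxtimes> N) N" and ev: "ev \<in> hom C (N \<boxtimes> H) \<I>" and \<eta>: "\<eta> \<in> hom C \<I> H"
    and y: "y \<in> hom C Y N"
  shows "underlying F Y y \<subseteq> left_integrals F H \<eta> N mN ev \<longleftrightarrow>
    mN \<cdot> (\<one> N \<otimes> y) = (ev \<cdot> (\<one> N \<otimes> \<eta>)) \<otimes> y"
proof -
  note [simp] = homD[OF mN] homD[OF ev] homD[OF \<eta>] homD[OF y]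
  have one: "One F \<in> Sp F \<I>"
    unfolding Sp_unit by (rule range_eqI[of _ _ 1]) simp
  have L: "Mp F (mN \<cdot> (\<one> N \<otimes> y)) (Tens F N Y g u) = Mp F mN (Tens F N N g (Mp F y u))"
    if "g \<in> Sp F N" "u \<in> Sp F Y" for g u
    using that Mp_comp[of "\<one> N \<otimes> y" "N \<boxtimes> Y" "N \<boxtimes> N" mN N] Mp_tens[OF ident_hom y]
    by (simp add: hom_iff Tens_in Mp_ident)
  have ev\<eta>: "Mp F (ev \<cdot> (\<one> N \<otimes> \<eta>)) g = Mp F ev (Tens F N H g (Mp F \<eta> (One F)))"
    if g: "g \<in> Sp F N" for g
    using Mp_comp[of "\<one> N \<otimes> \<eta>" N "N \<boxtimes> H" ev \<I> g] Mp_tens[OF ident_hom \<eta> g one] g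
    by (simp add: hom_iff Tens_unit Mp_ident)
  have R: "Mp F ((ev \<cdot> (\<one> N \<otimes> \<eta>)) \<otimes> y) (Tens F N Y g u)
      = Smult F (ev_at F N H ev g (Mp F \<eta> (One F))) (Mp F y u)"
    if g: "g \<in> Sp F N" and u: "u \<in> Sp F Y" for g u
  proof -
    have h: "ev \<cdot> (\<one> N \<otimes> \<eta>) \<in> hom C N \<I>"
      by (simp add: hom_iff)
    show ?thesis
      using Mp_tens[OF h y g u] unit_action[OF Mp_in[OF h g] Mp_in[OF y u]]
      by (simp add: ev_at_def ev\<eta>[OF g])
  qed
  show ?thesis
  proof
    assume sub: "underlying F Y y \<subseteq> left_integrals F H \<eta> N mN ev"
    show "mN \<cdot> (\<one> N \<otimes> y) = (ev \<cdot> (\<one> N \<otimes> \<eta>)) \<otimes> y"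
    proof (rule tensor_ext[of _ N Y N])
      fix g u assume "g \<in> Sp F N" "u \<in> Sp F Y"
      then show "Mp F (mN \<cdot> (\<one> N \<otimes> y)) (Tens F N Y g u) = Mp F ((ev \<cdot> (\<one> N \<otimes> \<eta>)) \<otimes> y) (Tens F N Y g u)"
        using sub L R by (auto simp: underlying_def left_integrals_def)
    qed (simp_all add: hom_iff)
  next
    assume "mN \<cdot> (\<one> N \<otimes> y) = (ev \<cdot> (\<one> N \<otimes> \<eta>)) \<otimes> y"
    then show "underlying F Y y \<subseteq> left_integrals F H \<eta> N mN ev"
      using L R Mp_in[OF y] by (auto simp: underlying_def left_integrals_def)
  qed
qed

end

section \<open>The rational part of the dual, its coinvariants and the integrals\<close>

theorem corollary2p2:
  fixes C :: "('o, 'm) tensor_cat" (structure)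
    and F :: "('k::field, 'o, 'm, 'v::ab_group_add) vect_functor"
    and H Hd Hrat :: 'o
    and m \<eta> \<Delta> \<epsilon> S mD \<eta>D ev \<alpha> j \<rho> harpoon harpoon_rat :: 'm
  assumes "braided_tensor_category C"
    and "forgetful_functor C F"
    and "has_equalizers C"
    and "braided_hopf_algebra C H m \<eta> \<Delta> \<epsilon> S"
    and "inverse_of C (\<sigma> H H) (\<sigma> H H)"
    and "faithful_quasi_dual C H \<Delta> \<epsilon> Hd mD \<eta>D ev"
    and "embedded_in_dual F Hd H ev"
    and "maximal_rational_submodule C F H Hd mD \<eta>D ev Hrat \<alpha> j"
    and "rational_coaction C H Hd ev Hrat \<alpha> \<rho>"
    and "is_harpoon C H m Hd ev harpoon"
    and "harpoon_rat \<in> hom C (H \<boxtimes> Hrat) Hrat"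
    and "j \<cdot> harpoon_rat = harpoon \<cdot> (\<one> H \<otimes> j)"
  shows "(\<exists>J i. subobject_on C F Hd (left_integrals F H \<eta> Hd mD ev) J i) \<and>
    (\<forall>J i. subobject_on C F Hd (left_integrals F H \<eta> Hd mD ev) J i \<longrightarrow>
      hopf_modules_isomorphic C H m \<eta> \<Delta> \<epsilon>
        Hrat (harpoon_rat \<cdot> (S \<otimes> \<one> Hrat) \<cdot> \<sigma> Hrat H) \<rho>
        (J \<boxtimes> H) (\<one> J \<otimes> m) (\<one> J \<otimes> \<Delta>))"
proof -
  interpret braided_tensor_category C by fact
  interpret F: forgetful_functor C F by fact
  interpret symmetric_hopf_dual C H m \<eta> \<Delta> \<epsilon> S Hd mD \<eta>D ev
    using assms(4,5,6) braided_tensor_category_axioms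
    by (simp add: symmetric_hopf_dual_def symmetric_hopf_algebra_def symmetric_hopf_algebra_axioms_def inverse_of_def)
  have harpoon [simp]: "Source C harpoon = H \<boxtimes> Hd" "Target C harpoon = Hd"
    using assms(10) by (simp_all add: is_harpoon_def hom_iff)
  interpret harpoon_action C H m \<eta> \<Delta> \<epsilon> S Hd mD \<eta>D ev "harpoon \<cdot> \<sigma> Hd H"
    by unfold_locales (simp_all add: harpoon_transpose[OF assms(10)])
  note [simp] = homD[OF assms(11)]
  have rat: "rational_submodule C F H Hd mD \<eta>D ev Hrat \<alpha> j"
    and max: "\<And>M' \<alpha>' j'. rational_submodule C F H Hd mD \<eta>D ev M' \<alpha>' j' \<Longrightarrow> \<exists>y \<in> hom C M' Hrat. j \<cdot> y = j'"
    using assms(8) by (auto simp: maximal_rational_submodule_def)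
  have M: "left_module_in C Hd mD \<eta>D Hrat \<alpha>" and sub: "subobject C F Hd Hrat j"
    and j\<alpha>: "j \<cdot> \<alpha> = mD \<cdot> (\<one> Hd \<otimes> j)"
    using rat by (auto simp: rational_submodule_def)
  have j_hom: "j \<in> hom C Hrat Hd"
    using sub by (simp add: subobject_def)
  note [simp] = homD[OF j_hom] homD[OF left_module_in.action_hom[OF M]]
  have \<rho>_ends [simp]: "Source C \<rho> = Hrat" "Target C \<rho> = Hrat \<boxtimes> H"
    using assms(9) by (simp_all add: rational_coaction_def hom_iff)
  have \<rho>: "T Hrat \<cdot> (\<one> Hd \<otimes> \<rho>) = \<alpha>"
    using assms(9) by (simp add: rational_coaction_def T_def)
  have mono: "x = y" if "Source C x = Source C y" "Target C x = Hrat" "Target C y = Hrat" "j \<cdot> x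
      = j \<cdot> y" for x y
    using F.subobject_mono[OF sub _ _ that(4)] that by (auto simp: hom_iff)
  define b where "b = harpoon_rat \<cdot> (S \<otimes> \<one> Hrat) \<cdot> \<sigma> Hrat H"
  have b_ends [simp]: "Source C b = Hrat \<boxtimes> H" "Target C b = Hrat"
    by (simp_all add: b_def)
  \<comment> \<open>Naturality moves \<open>S\<close> and \<open>j\<close> through the braiding,
    which identifies \<open>b\<close> as the restriction of \<open>\<beta>\<close> along
    \<open>j\<close>.\<close>
  have "j \<cdot> b = (harpoon \<cdot> (\<one> H \<otimes> j)) \<cdot> (S \<otimes> \<one> Hrat) \<cdot> \<sigma> Hrat H"
    unfolding assms(12)[symmetric] by (simp add: b_def)
  also have "\<dots> = harpoon \<cdot> (S \<otimes> j) \<cdot> \<sigma> Hrat H"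
    by (simp add: interchange_tail)
  also have "\<dots> = \<beta> \<cdot> (j \<otimes> \<one> H)"
    by (simp add: \<beta>_def interchanges braid_nat)
  finally have jb: "j \<cdot> b = \<beta> \<cdot> (j \<otimes> \<one> H)" .
  have hopf: "hopf_mod Hrat b \<rho>"
    by (rule rational_hopf_module[OF M, where j = j]) (simp_all add: \<rho> j\<alpha> jb mono)
  have b_mod: "hmodule Hrat b"
    using hopf by (simp add: hopf_module_def)
  define P where "P = b \<cdot> (\<one> Hrat \<otimes> S) \<cdot> \<rho>"
  have P_ends [simp]: "Source C P = Hrat" "Target C P = Hrat"
    by (simp_all add: P_def)
  have \<rho>P: "\<rho> \<cdot> P = P \<otimes> \<eta>"
    unfolding P_def by (rule coinvariant_projection(2)[OF hopf])
  have Pz: "P \<cdot> z = z" if "Target C z = Hrat" "\<rho> \<cdot> z = z \<otimes> \<eta>" for z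
    using projection_of_coinvariant[OF b_mod that] that by (simp add: P_def)
  let ?I = "left_integrals F H \<eta> Hd mD ev"
  have int: "underlying F Y (j \<cdot> z) \<subseteq> ?I \<longleftrightarrow> \<rho> \<cdot> z = z \<otimes> \<eta>" if "z \<in> hom C Y Hrat" for Y z
    using F.integrals_iff[OF N.mult_hom N.ev_hom unit_hom comp_hom[OF that j_hom]]
      coinvariant_iff[of \<alpha> Hrat \<rho> j z] homD[OF that] \<rho> j\<alpha> mono by simp
  \<comment> \<open>The trivial action on \<open>Y\<close> is rational by
    \<open>T_coinvariant\<close>, and that \<open>y\<close> consists of integrals says that
    \<open>y\<close> is linear for it. Maximality then supplies \<open>z\<close>.\<close>
  have factor: "\<exists>z \<in> hom C Y Hrat. j \<cdot> z = y" if "subobject C F Hd Y y" "underlying F Y y \<subseteq> ?I" for Y y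
  proof (rule max)
    have y: "y \<in> hom C Y Hd"
      using that(1) by (simp add: subobject_def)
    note [simp] = homD[OF y]
    have eq: "mD \<cdot> (\<one> Hd \<otimes> y) = e \<otimes> y"
      using F.integrals_iff[OF N.mult_hom N.ev_hom unit_hom y] that(2) by simp
    have "rational_coaction C H Hd ev Y (e \<otimes> \<one> Y) (\<one> Y \<otimes> \<eta>)"
      using T_coinvariant[of "\<one> Y" Y] by (simp add: rational_coaction_def T_def hom_iff)
    then show "rational_submodule C F H Hd mD \<eta>D ev Y (e \<otimes> \<one> Y) y"
      unfolding rational_submodule_def using trivial_module that(1) eq interchange[of e "\<one> \<I>" "\<one> Y" y]
      by auto
  qed
  have P_hom: "P \<in> hom C Hrat Hrat"
    by (simp add: hom_iff)
  obtain E0 i0 where "is_equalizer C Hrat P (\<one> Hrat) E0 i0"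
    using assms(3) P_hom ident_hom[of Hrat] unfolding has_equalizers_def by blast
  then have i0: "i0 \<in> hom C E0 Hrat" and Pi0: "P \<cdot> i0 = i0"
    and univ: "\<And>X x. \<lbrakk>x \<in> hom C X Hrat; P \<cdot> x = x\<rbrakk> \<Longrightarrow> \<exists>!y. y \<in> hom C X E0 \<and> i0 \<cdot> y = x"
    by (auto simp: is_equalizer_def hom_iff)
  note [simp] = homD[OF i0]
  have PP: "P \<cdot> P = P"
    by (rule Pz) (simp_all add: \<rho>P)
  \<comment> \<open>Being idempotent, \<open>P\<close> factors through the equalizer
    \<open>i0\<close> of itself and the identity; this factor is the retraction.\<close>
  obtain p0 where p0: "p0 \<in> hom C Hrat E0" and ip: "i0 \<cdot> p0 = P"
    using univ[of P Hrat] PP by (auto simp: hom_iff)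
  note [simp] = homD[OF p0]
  have pi: "p0 \<cdot> i0 = \<one> E0"
  proof -
    have "i0 \<cdot> (p0 \<cdot> i0) = i0"
      using comp_tail[OF ip, of i0] Pi0 by simp
    then show ?thesis
      using univ[OF i0 Pi0] by (metis comp_hom comp_ident_right i0 ident_hom p0)
  qed
  have \<rho>i0: "\<rho> \<cdot> i0 = i0 \<otimes> \<eta>"
  proof -
    have "\<rho> \<cdot> i0 = (\<rho> \<cdot> P) \<cdot> i0"
      by (simp add: Pi0)
    also have "\<dots> = i0 \<otimes> \<eta>"
      unfolding \<rho>P using interchange[of i0 P "\<one> \<I>" \<eta>] by (simp add: Pi0)
    finally show ?thesis .
  qed
  \<comment> \<open>A subobject of integrals factors through \<open>j\<close> by maximality; the
    factor is coinvariant, so \<open>P\<close> fixes it and it passes through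
    \<open>i0\<close>.\<close>
  have E0: "subobject_on C F Hd ?I E0 (j \<cdot> i0)"
    unfolding subobject_on_def
  proof (intro conjI allI impI)
    show "subobject C F Hd E0 (j \<cdot> i0)"
      by (rule F.subobject_comp[OF F.subobject_split[OF i0 p0 pi] sub])
    show "underlying F E0 (j \<cdot> i0) \<subseteq> ?I"
      using int[OF i0] \<rho>i0 by simp
    fix Y y assume Y: "subobject C F Hd Y y \<and> underlying F Y y \<subseteq> ?I"
    then obtain z where z: "z \<in> hom C Y Hrat" "j \<cdot> z = y"
      using factor by blast
    then have "P \<cdot> z = z"
      using int[OF z(1)] Y Pz homD[OF z(1)] by simp
    then obtain x where "x \<in> hom C Y E0" "i0 \<cdot> x = z"
      using univ[OF z(1)] by blast
    then show "\<exists>x \<in> hom C Y E0. (j \<cdot> i0) \<cdot> x = y"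
      using z by (intro bexI[of _ x]) (auto simp: hom_iff)
  qed
  \<comment> \<open>Any other largest subobject \<open>J\<close> lies in the rational part by
    \<open>z\<close> and receives \<open>w\<close> from \<open>E0\<close>. Then \<open>z\<close> and
    \<open>w \<cdot> p0\<close> split \<open>P\<close> through \<open>J\<close> itself, so the
    fundamental theorem applies to \<open>J\<close> directly.\<close>
  moreover have "hopf_modules_isomorphic C H m \<eta> \<Delta> \<epsilon> Hrat b \<rho> (J \<boxtimes> H) (\<one> J \<otimes> m) (\<one> J \<otimes> \<Delta>)"
    if J: "subobject_on C F Hd ?I J i" for J i
  proof -
    have Js: "subobject C F Hd J i" and Ju: "underlying F J i \<subseteq> ?I"
      using J by (auto simp: subobject_on_def)
    obtain z where z: "z \<in> hom C J Hrat" "j \<cdot> z = i"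
      using factor[OF Js Ju] by blast
    note [simp] = homD[OF z(1)]
    have Pz': "P \<cdot> z = z"
      using int[OF z(1)] Ju z(2) Pz by simp
    obtain w where w: "w \<in> hom C E0 J" "i \<cdot> w = j \<cdot> i0"
      using J E0 unfolding subobject_on_def by blast
    note [simp] = homD[OF w(1)]
    have zw: "z \<cdot> w = i0"
      by (rule mono) (simp_all add: comp_tail[OF z(2)] w(2))
    let ?p = "w \<cdot> p0"
    have zp: "z \<cdot> ?p = P"
      using comp_tail[OF zw, of p0] ip by simp
    have "i \<cdot> (?p \<cdot> z) = i \<cdot> \<one> J"
      unfolding z(2)[symmetric] using comp_tail[OF zp, of z] Pz' by simp
    then have pz: "?p \<cdot> z = \<one> J"
      by (rule F.subobject_mono[OF Js, rotated -1]) (simp_all add: hom_iff)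
    show ?thesis
      unfolding hopf_modules_isomorphic_def
      by (rule exI, rule fundamental_theorem[OF hopf _ _ _ _ _ pz]) (simp_all add: zp flip: P_def)
  qed
  ultimately show ?thesis
    unfolding b_def by blast
qed

end
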